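(* Let $\Omega,\Omega^*\subseteq\mathbb R^2$ be open and simply connected, $a>0$, $c>a$, $T:\Omega\to\Omega^*$ a $C^2$ bijective map, $Sx=Tx-x$, $n_1,n_2,n_3>0$ with $n_2>n_1$, $\kappa_1=n_2/n_1$. Let $x_0\in\Omega$ be such that $a>\dfrac{|Sx_0|}{\sqrt{\kappa_1^2-1}}$, and assume that $\nabla\times S=0$ and $S\times D|S|^2=0$ in a neighborhood of $x_0$. Then for every $z_0$ with $a>z_0>\dfrac{|Sx_0|}{\sqrt{\kappa_1^2-1}}$ there exists, in a neighborhood of $x_0$, a positive $C^3$ solution $\rho$ to $$D\rho(x)=\frac{\kappa_1\,Sx}{\sqrt{|Sx|^2+(a-\rho(x))^2}-\kappa_1(a-\rho(x))}$$ such that $a-\rho(x_0)=z_0$, and the surface $\sigma_1=\{(x,\rho(x))\}$ separating media I and II refracts the vertical rays emitted from $(x,0)$, $x$ in a neighborhood of $x_0$, into $(Tx,a)$. If moreover $T$ is a diffeomorphism in a neighborhood of $x_0$, and either (1) $Sx_0=(0,0)$ and $DS(x_0)$ is invertible, or (2) $Sx_0\neq(0,0)$, $\zeta\neq\dfrac{|Sx_0|^2}{z_0^2}\,\varphi\!\left(\left|\dfrac{Sx_0}{z_0}\right|^2\right)$ and $\zeta_\perp\neq0$, where $\zeta,\zeta_\perp$ are the eigenvalues of $DS(x_0)$ corresponding to the eigenvectors $S^t$ and $S_\perp^t$ at $x_0$, then there exists a $C^1$ phase discontinuity $\phi$ defined in a neighborhood of every point $(Tx,a)\in\sigma_2$,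 $x$ in a neighborhood of $x_0$, such that the ray at $(Tx,a)$ is refracted by the metasurface $(\sigma_2,\phi)$ vertically into the point $(Tx,c)$.
   Context: Vectors are row vectors; $D\rho$ is the row gradient; $DS=(\partial S_i/\partial x_j)_{i,j}$. For a planar $C^1$ field $S=(S_1,S_2)$, $\nabla\times S=(S_2)_{x_1}-(S_1)_{x_2}$; for planar vectors ${\bf a}\times{\bf b}=a_1b_2-a_2b_1$; $S_\perp=(-S_2,S_1)$. The conditions $\nabla\times S=0$, $S\times D|S|^2=0$ mean that $DS$ is symmetric and $(DS)S^t$ is parallel to $S^t$, so where $S\ne(0,0)$ both $S^t$ and $S_\perp^t$ are eigenvectors of $DS$. $\varphi(y)=\dfrac{\kappa_1}{\kappa_1-\sqrt{y+1}}$ for $y\in[0,\kappa_1^2-1)$. Refraction at $\sigma_1$. Medium I (index $n_1$) is below $\sigma_1$, medium II (index $n_2$) is between $\sigma_1$ and the plane $\{x_3=a\}$, medium III (index $n_3$) is above that plane; $\kappa_2=n_3/n_2$; $k>0$ is the wave number in medium II. With $\nu(x)=\dfrac{(-D\rho(x),1)}{\sqrt{1+|D\rho(x)|^2}}$ the upward unit normal, the vertical ray with direction ${\bf e}=(0,0,1)$ from $(x,0)$ is refracted at $(x,\rho(x))$ into the unit direction $${\bf m}(x)=\frac1{\kappa_1}({\bf e}-\lambda\nu(x)),\qquad\lambda={\bf e}\cdot\nu(x)-\sqrt{\kappa_1^2-1+({\bf e}\cdot\nu(x))^2};$$ it is refracted into $(Tx,a)$ if $0<\rho(x)<a$ and ${\bf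 m}(x)=\dfrac{(Tx,a)-(x,\rho(x))}{|(Tx,a)-(x,\rho(x))|}$. Refraction at the metasurface. $\sigma_2\subset\{x_3=a\}$ consists of the points $(Tx,a)$, $x$ near $x_0$, and $\phi(u_1,u_2,u_3)$ is a $C^1$ real function on an open set of $\mathbb R^3$ containing these points. The ray with direction ${\bf m}(x)$ reaching $(Tx,a)$ is refracted by $(\sigma_2,\phi)$ into the vertical direction ${\bf w}=(0,0,1)$ (hence into $(Tx,c)$) if the generalized Snell law holds: $${\bf m}(x)-\tfrac1k\nabla\phi(Tx,a)-\kappa_2{\bf w}=\mu\,(0,0,1),$$ where, with ${\bf q}={\bf m}(x)-\frac1k\nabla\phi(Tx,a)$ and $q_3$ its third component, $\mu=q_3-\sqrt{\kappa_2^2-|{\bf q}|^2+q_3^2}$, and the quantity under the square root is required to be nonnegative. *)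

theory Defs
  imports "HOL-Analysis.Analysis"
begin

definition partial :: "'n::finite \<Rightarrow> (real^'n \<Rightarrow> 'b::real_normed_vector) \<Rightarrow> real^'n \<Rightarrow> 'b" where
  "partial j f x = frechet_derivative f (at x) (axis j 1)"

definition grad :: "(real^'n \<Rightarrow> real) \<Rightarrow> real^'n \<Rightarrow> real^'n::finite" where
  "grad f x = (\<chi> j. partial j f x)"

(* Class C^k on U; only meaningful for open U, since derivatives are taken at x, not within U. *)
primrec Ck_on :: "nat \<Rightarrow> (real^'n::finite \<Rightarrow> 'b::real_normed_vector) \<Rightarrow> (real^'n) set \<Rightarrow> bool" where
  "Ck_on 0 f U \<longleftrightarrow> continuous_on U f"
| "Ck_on (Suc k) f U \<longleftrightarrow>
     (\<forall>x\<in>U. f differentiable (at x)) \<and> (\<forall>j. Ck_on k (partial j f) U)"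

(* C^1 diffeomorphism of N onto its image; if f is C^k, the inverse is then C^k as well. *)
definition diffeomorphism_on :: "(real^'n::finite \<Rightarrow> real^'n) \<Rightarrow> (real^'n) set \<Rightarrow> bool" where
  "diffeomorphism_on f N \<longleftrightarrow>
     open N \<and> open (f ` N) \<and> inj_on f N \<and> Ck_on 1 f N \<and> Ck_on 1 (inv_into N f) (f ` N)"

definition cross2 :: "real^2 \<Rightarrow> real^2 \<Rightarrow> real" where
  "cross2 v w = v$1 * w$2 - v$2 * w$1"

definition curl2 :: "(real^2 \<Rightarrow> real^2) \<Rightarrow> real^2 \<Rightarrow> real" where
  "curl2 F x = jacobian F (at x) $ 2 $ 1 - jacobian F (at x) $ 1 $ 2"

definition perp :: "real^2 \<Rightarrow> real^2" where
  "perp v = vector [- (v$2), v$1]"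

definition varphi :: "real \<Rightarrow> real \<Rightarrow> real" where
  "varphi \<kappa>\<^sub>1 y = \<kappa>\<^sub>1 / (\<kappa>\<^sub>1 - sqrt (y + 1))"

definition pt3 :: "real^2 \<Rightarrow> real \<Rightarrow> real^3" where
  "pt3 x t = vector [x$1, x$2, t]"

definition vertical :: "real^3" where
  "vertical = vector [0, 0, 1]"

definition unit_normal :: "(real^2 \<Rightarrow> real) \<Rightarrow> real^2 \<Rightarrow> real^3" where
  "unit_normal \<rho> x = pt3 (- grad \<rho> x) 1 /\<^sub>R sqrt (1 + (norm (grad \<rho> x))\<^sup>2)"

(* Direction of a vertical ray after refraction by the graph of rho at (x, rho x). *)
definition refracted_dir :: "real \<Rightarrow> (real^2 \<Rightarrow> real) \<Rightarrow> real^2 \<Rightarrow> real^3" where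
  "refracted_dir \<kappa>\<^sub>1 \<rho> x =
     (let \<nu> = unit_normal \<rho> x;
          l = vertical \<bullet> \<nu> - sqrt (\<kappa>\<^sub>1\<^sup>2 - 1 + (vertical \<bullet> \<nu>)\<^sup>2)
      in (1 / \<kappa>\<^sub>1) *\<^sub>R (vertical - l *\<^sub>R \<nu>))"

(* The vertical ray from (x,0) is refracted by the graph of rho into the point (y,a). *)
definition refracts_into ::
    "real \<Rightarrow> (real^2 \<Rightarrow> real) \<Rightarrow> real \<Rightarrow> real^2 \<Rightarrow> real^2 \<Rightarrow> bool" where
  "refracts_into \<kappa>\<^sub>1 \<rho> a x y \<longleftrightarrow>
     0 < \<rho> x \<and> \<rho> x < a \<and>
     refracted_dir \<kappa>\<^sub>1 \<rho> x =
       (pt3 y a - pt3 x (\<rho> x)) /\<^sub>R norm (pt3 y a - pt3 x (\<rho> x))"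

(* Generalized Snell law: the ray with direction m reaching (y,a) leaves the metasurface in the
   vertical direction; the last conjunct says that it then hits the point (y,c). *)
definition metasurface_refracts_vertically_into ::
    "real \<Rightarrow> real \<Rightarrow> (real^3 \<Rightarrow> real) \<Rightarrow> real^3 \<Rightarrow> real^2 \<Rightarrow> real \<Rightarrow> real \<Rightarrow> bool" where
  "metasurface_refracts_vertically_into k \<kappa>\<^sub>2 \<phi> m y a c \<longleftrightarrow>
     (let q = m - (1 / k) *\<^sub>R grad \<phi> (pt3 y a);
          d = \<kappa>\<^sub>2\<^sup>2 - (norm q)\<^sup>2 + (q$3)\<^sup>2;
          \<mu> = q$3 - sqrt d
      in 0 \<le> d \<and> q - \<kappa>\<^sub>2 *\<^sub>R vertical = \<mu> *\<^sub>R vertical) \<and>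
     (\<exists>t>0. pt3 y c = pt3 y a + t *\<^sub>R vertical)"

end

theory Submission
  imports Defs
begin

text \<open>
  With \<open>z = a - \<rho>\<close> the equation reads \<open>D z = F (x, z) = g (x, z) S\<close>, where \<open>g\<close> depends on \<open>x\<close> only
  through \<open>|S|\<^sup>2\<close>. In the Picard iteration \<open>D u\<^bsub>n+1\<^esub> = F (x, u\<^sub>n)\<close> all gradients are parallel to \<open>S\<close>,
  hence \<open>D (g (x, u\<^sub>n))\<close> is a combination of \<open>D |S|\<^sup>2\<close> and \<open>D u\<^sub>n\<close>, both parallel to \<open>S\<close>; together with
  \<open>\<nabla> \<times> S = 0\<close> the field \<open>F (x, u\<^sub>n)\<close> is curl-free and the Poincare lemma on a ball provides the next
  iterate. On a small ball the iteration contracts, and its limit solves the equation.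

  By Malus' theorem the phase can be written down: it is a multiple of the optical path length,
  transported to the metasurface by the inverse of \<open>T\<close>.
\<close>

subsection \<open>Calculus of the classes C^k\<close>

lemma partial_eqI: "(f has_derivative f') (at x) \<Longrightarrow> partial j f x = f' (axis j 1)"
  unfolding partial_def using frechet_derivative_at by metis

lemma has_derivative_partials:
  fixes f :: "real^'n \<Rightarrow> 'b::real_normed_vector"
  assumes "f differentiable (at x)"
  shows "(f has_derivative (\<lambda>h. \<Sum>j\<in>UNIV. h $ j *\<^sub>R partial j f x)) (at x)"
proof -
  obtain f' where f': "(f has_derivative f') (at x)"
    using assms unfolding differentiable_def by blast
  have "f' h = (\<Sum>j\<in>UNIV. h $ j *\<^sub>R partial j f x)" for h
  proof -
    have "f' h = f' (\<Sum>j\<in>UNIV. h $ j *\<^sub>R axis j 1)"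
      by (simp add: basis_expansion flip: scalar_mult_eq_scaleR)
    also have "\<dots> = (\<Sum>j\<in>UNIV. h $ j *\<^sub>R partial j f x)"
      using has_derivative_linear[OF f'] f' by (simp add: linear_sum linear_scale partial_eqI)
    finally show ?thesis .
  qed
  then have "f' = (\<lambda>h. \<Sum>j\<in>UNIV. h $ j *\<^sub>R partial j f x)" by blast
  with f' show ?thesis by simp
qed

lemma has_derivative_grad:
  "f differentiable (at x) \<Longrightarrow> (f has_derivative (\<lambda>h. grad f x \<bullet> h)) (at x)"
  using has_derivative_partials[of f x]
  by (simp add: inner_vec_def grad_def mult.commute)

lemma grad_eqI: "(f has_derivative (\<lambda>h. v \<bullet> h)) (at x) \<Longrightarrow> grad f x = v"
  by (simp add: vec_eq_iff grad_def partial_eqI inner_axis)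

lemma has_derivative_cong_open:
  assumes "open U" "x \<in> U" "\<And>y. y \<in> U \<Longrightarrow> f y = g y"
  shows "(f has_derivative F) (at x) \<longleftrightarrow> (g has_derivative F) (at x)"
  using has_derivative_transform_within_open[of f F x UNIV U g]
    has_derivative_transform_within_open[of g F x UNIV U f] assms by auto

lemma partial_cong_open:
  assumes "open U" "x \<in> U" "\<And>y. y \<in> U \<Longrightarrow> f y = g y"
  shows "partial j f x = partial j g x"
  unfolding partial_def frechet_derivative_def
  by (simp only: has_derivative_cong_open[of U x f g, OF assms])

lemma differentiable_cong_open:
  assumes "open U" "x \<in> U" "\<And>y. y \<in> U \<Longrightarrow> f y = g y"
  shows "f differentiable (at x) \<longleftrightarrow> g differentiable (at x)"
  unfolding differentiable_def by (simp only: has_derivative_cong_open[of U x f g, OF assms])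

text \<open>Openness matters: partial derivatives are taken in the full space, and only on an open
  set do the values of \<open>f\<close> there determine them and, by induction, all higher
  ones.\<close>

lemma Ck_on_cong:
  assumes "open U" "\<And>y. y \<in> U \<Longrightarrow> f y = g y"
  shows "Ck_on k f U \<longleftrightarrow> Ck_on k g U"
  using assms(2)
proof (induction k arbitrary: f g)
  case 0
  then show ?case by (simp cong: continuous_on_cong)
next
  case (Suc k)
  have "Ck_on k (partial j f) U \<longleftrightarrow> Ck_on k (partial j g) U" for j
    by (rule Suc.IH) (rule partial_cong_open[OF assms(1)], simp_all add: Suc.prems)
  moreover have "\<forall>x\<in>U. f differentiable (at x) \<longleftrightarrow> g differentiable (at x)"
    using differentiable_cong_open[of U _ f g] assms(1) Suc.prems by simp
  ultimately show ?case by auto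
qed

lemma Ck_on_subset: "Ck_on k f U \<Longrightarrow> V \<subseteq> U \<Longrightarrow> Ck_on k f V"
  by (induction k arbitrary: f) (auto intro: continuous_on_subset)

lemma Ck_on_continuous: "Ck_on k f U \<Longrightarrow> continuous_on U f"
  by (cases k) (auto intro!: continuous_at_imp_continuous_on differentiable_imp_continuous_within)

lemma Ck_on_SucD: "Ck_on (Suc k) f U \<Longrightarrow> Ck_on k f U"
proof (induction k arbitrary: f)
  case 0
  then show ?case using Ck_on_continuous[OF 0] by simp
next
  case (Suc k)
  then show ?case unfolding Ck_on.simps(2)[of "Suc k"] by (subst Ck_on.simps) blast
qed

lemma Ck_on_partial: "Ck_on (Suc k) f U \<Longrightarrow> Ck_on k (partial j f) U"
  by simp

lemma Ck_on_differentiable: "Ck_on (Suc k) f U \<Longrightarrow> x \<in> U \<Longrightarrow> f differentiable (at x)"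
  by simp

text \<open>Any explicit formula for the derivative will do, since uniqueness of derivatives
  identifies its values on the axes with the partials. The inductions below and the gain of
  regularity for \<open>\<rho>\<close> rest on this form.\<close>

lemma Ck_on_SucI:
  assumes "open U" "\<And>x. x \<in> U \<Longrightarrow> (f has_derivative f' x) (at x)"
    "\<And>j. Ck_on k (\<lambda>x. f' x (axis j 1)) U"
  shows "Ck_on (Suc k) f U"
proof -
  have "Ck_on k (partial j f) U" for j
    using assms(3) Ck_on_cong[OF assms(1), of "partial j f" "\<lambda>x. f' x (axis j 1)" k]
      partial_eqI[OF assms(2)] by blast
  then show ?thesis using assms(2) by (auto simp: differentiable_def)
qed

section \<open>Closure of the classes C^k under linear maps, sums, products, reciprocals and square
  roots\<close>

lemma Ck_on_const:
  fixes U :: "(real^'n) set"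
  shows "Ck_on k (\<lambda>x. c) U"
proof (induction k arbitrary: c)
  case (Suc k)
  have "partial j (\<lambda>x::real^'n. c) = (\<lambda>x. 0)" for j
    by (rule ext) (rule partial_eqI[OF has_derivative_const])
  then show ?case using Suc[of 0] by simp
qed simp

lemma Ck_on_bounded_linear:
  assumes "open U" "bounded_linear L"
  shows "Ck_on k f U \<Longrightarrow> Ck_on k (\<lambda>x. L (f x)) U"
proof (induction k arbitrary: f)
  case 0
  then show ?case using bounded_linear.continuous_on[OF assms(2)] by auto
next
  case (Suc k)
  show ?case
  proof (rule Ck_on_SucI[OF assms(1)])
    fix x assume "x \<in> U"
    then show "((\<lambda>x. L (f x)) has_derivative
        (\<lambda>h. L (\<Sum>j\<in>UNIV. h $ j *\<^sub>R partial j f x))) (at x)"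
      using Suc.prems by (intro bounded_linear.has_derivative[OF assms(2)] has_derivative_partials) auto
  next
    fix j
    have "(\<Sum>i\<in>UNIV. axis j 1 $ i *\<^sub>R partial i f x) = partial j f x" for x
      by (simp add: axis_def if_distrib[of "\<lambda>c. c *\<^sub>R _"] cong: if_cong)
    then show "Ck_on k (\<lambda>x. L (\<Sum>i\<in>UNIV. axis j 1 $ i *\<^sub>R partial i f x)) U"
      using Suc by simp
  qed
qed

lemma Ck_on_id:
  assumes "open U"
  shows "Ck_on k (\<lambda>x. x) U"
proof (cases k)
  case (Suc k)
  show ?thesis
    unfolding Suc by (rule Ck_on_SucI[OF assms has_derivative_ident Ck_on_const])
qed simp

lemma frechet_has_derivative:
  "f differentiable (at x) \<Longrightarrow> (f has_derivative frechet_derivative f (at x)) (at x)"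
  by (simp add: frechet_derivative_works)

lemma Ck_on_add:
  assumes "open U"
  shows "Ck_on k f U \<Longrightarrow> Ck_on k g U \<Longrightarrow> Ck_on k (\<lambda>x. f x + g x) U"
proof (induction k arbitrary: f g)
  case 0
  then show ?case by (auto intro: continuous_on_add)
next
  case (Suc k)
  show ?case
  proof (rule Ck_on_SucI[OF assms has_derivative_add])
    show "(f has_derivative frechet_derivative f (at x)) (at x)"
      "(g has_derivative frechet_derivative g (at x)) (at x)" if "x \<in> U" for x
      using Suc.prems that by (auto intro: frechet_has_derivative)
    show "Ck_on k (\<lambda>x. frechet_derivative f (at x) (axis j 1) +
        frechet_derivative g (at x) (axis j 1)) U" for j
      unfolding partial_def[symmetric] by (intro Suc.IH Ck_on_partial Suc.prems)
  qed
qed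

text \<open>The product rule pairs a partial of one factor with the other factor undifferentiated.
  The latter also has order \<open>k\<close> by \<open>Ck_on_SucD\<close>, and the induction
  hypothesis covers both mixed products because \<open>f\<close> and \<open>g\<close> vary.\<close>

lemma Ck_on_scaleR:
  fixes f :: "real^'n \<Rightarrow> real"
  assumes "open U"
  shows "Ck_on k f U \<Longrightarrow> Ck_on k g U \<Longrightarrow> Ck_on k (\<lambda>x. f x *\<^sub>R g x) U"
proof (induction k arbitrary: f g)
  case 0
  then show ?case by (auto intro: continuous_on_scaleR)
next
  case (Suc k)
  show ?case
  proof (rule Ck_on_SucI[OF assms has_derivative_scaleR])
    show "(f has_derivative frechet_derivative f (at x)) (at x)"
      "(g has_derivative frechet_derivative g (at x)) (at x)" if "x \<in> U" for x
      using Suc.prems that by (auto intro: frechet_has_derivative)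
    show "Ck_on k (\<lambda>x. f x *\<^sub>R frechet_derivative g (at x) (axis j 1) +
        frechet_derivative f (at x) (axis j 1) *\<^sub>R g x) U" for j
      unfolding partial_def[symmetric]
      by (intro Ck_on_add[OF assms] Suc.IH Ck_on_partial Suc.prems
          Ck_on_SucD[OF Suc.prems(1)] Ck_on_SucD[OF Suc.prems(2)])
  qed
qed

lemma Ck_on_mult:
  fixes f g :: "real^'n \<Rightarrow> real"
  shows "open U \<Longrightarrow> Ck_on k f U \<Longrightarrow> Ck_on k g U \<Longrightarrow> Ck_on k (\<lambda>x. f x * g x) U"
  using Ck_on_scaleR[of U k f g] by simp

lemma Ck_on_diff:
  assumes "open U" "Ck_on k f U" "Ck_on k g U"
  shows "Ck_on k (\<lambda>x. f x - g x) U"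
  using Ck_on_add[OF assms(1,2) Ck_on_scaleR[OF assms(1) Ck_on_const assms(3), of "-1"]] by simp

text \<open>The derivative of \<open>inverse f\<close> is built from \<open>inverse f\<close> itself
  and the partials of \<open>f\<close>, so order \<open>k\<close> of the reciprocal feeds the step
  to \<open>Suc k\<close>. The square root below works in the same way.\<close>

lemma Ck_on_inverse:
  fixes f :: "real^'n \<Rightarrow> real"
  assumes "open U" "\<And>x. x \<in> U \<Longrightarrow> f x \<noteq> 0"
  shows "Ck_on k f U \<Longrightarrow> Ck_on k (\<lambda>x. inverse (f x)) U"
proof (induction k)
  case 0
  then show ?case using assms by (auto intro: continuous_on_inverse)
next
  case (Suc k)
  have k: "Ck_on k (\<lambda>x. inverse (f x)) U" "\<And>j. Ck_on k (partial j f) U"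
    using Suc Ck_on_SucD by auto
  show ?case
  proof (rule Ck_on_SucI[OF assms(1)])
    fix x assume x: "x \<in> U"
    then show "((\<lambda>x. inverse (f x)) has_derivative
        (\<lambda>h. - (inverse (f x) * frechet_derivative f (at x) h * inverse (f x)))) (at x)"
      using Suc.prems assms(2) x by (intro Deriv.has_derivative_inverse frechet_has_derivative) auto
  next
    fix j
    show "Ck_on k (\<lambda>x. - (inverse (f x) * frechet_derivative f (at x) (axis j 1) * inverse (f x))) U"
      using Ck_on_mult[OF assms(1) Ck_on_const[of k "-1"]
          Ck_on_mult[OF assms(1) Ck_on_mult[OF assms(1) k(1) k(2)[of j]] k(1)]]
      by (simp flip: partial_def)
  qed
qed

lemma Ck_on_sqrt:
  fixes f :: "real^'n \<Rightarrow> real"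
  assumes "open U" "\<And>x. x \<in> U \<Longrightarrow> f x > 0"
  shows "Ck_on k f U \<Longrightarrow> Ck_on k (\<lambda>x. sqrt (f x)) U"
proof (induction k)
  case 0
  then show ?case by (auto intro: continuous_on_real_sqrt)
next
  case (Suc k)
  have k: "Ck_on k (\<lambda>x. sqrt (f x)) U" "\<And>j. Ck_on k (partial j f) U"
    using Suc Ck_on_SucD by auto
  have "Ck_on k (\<lambda>x. inverse (sqrt (f x))) U"
    using assms(2) by (intro Ck_on_inverse[OF assms(1) _ k(1)]) force
  note k' = Ck_on_mult[OF assms(1) Ck_on_mult[OF assms(1) k(2) this] Ck_on_const[of k "1/2"]]
  show ?case
  proof (rule Ck_on_SucI[OF assms(1)])
    fix x assume x: "x \<in> U"
    then show "((\<lambda>x. sqrt (f x)) has_derivative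
        (\<lambda>h. frechet_derivative f (at x) h * (inverse (sqrt (f x)) / 2))) (at x)"
      using Suc.prems assms(2) by (intro has_derivative_real_sqrt frechet_has_derivative) auto
  next
    fix j
    show "Ck_on k (\<lambda>x. frechet_derivative f (at x) (axis j 1) * (inverse (sqrt (f x)) / 2)) U"
      using k'[of j] by (simp flip: partial_def)
  qed
qed

subsection \<open>Potentials and gradient equations\<close>

text \<open>Poincare lemma: the potential integrates \<open>\<omega>\<close> along the segment from
  \<open>x0\<close> to \<open>x\<close>. By symmetry of \<open>\<omega>'\<close>, differentiating
  under the integral produces the \<open>t\<close>-derivative of
  \<open>t *\<^sub>R \<omega> (p x t)\<close>, which integrates to
  \<open>\<omega> x\<close>.\<close>

lemma closed_field_has_potential:
  fixes \<omega> :: "'a::euclidean_space \<Rightarrow> 'a"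
  assumes der: "\<And>x. x \<in> ball x0 r \<Longrightarrow> (\<omega> has_derivative \<omega>' x) (at x)"
    and cont: "continuous_on (ball x0 r \<times> UNIV) (\<lambda>(x, h). \<omega>' x h)"
    and sym: "\<And>x h l. x \<in> ball x0 r \<Longrightarrow> \<omega>' x h \<bullet> l = \<omega>' x l \<bullet> h"
  obtains f where "f x0 = c" "\<And>x. x \<in> ball x0 r \<Longrightarrow> (f has_derivative (\<lambda>h. \<omega> x \<bullet> h)) (at x)"
proof -
  define p where "p x t = x0 + t *\<^sub>R (x - x0)" for x and t :: real
  have p: "p x t \<in> ball x0 r" if "x \<in> ball x0 r" "t \<in> {0..1}" for x t
  proof -
    have "norm (t *\<^sub>R (x - x0)) \<le> norm (x - x0)"
      using that by (simp add: mult_left_le_one_le)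
    then show ?thesis using that by (simp add: p_def dist_norm norm_minus_commute)
  qed
  \<comment> \<open>By the product rule this is the derivative in \<open>t\<close> of
    \<open>t *\<^sub>R \<omega> (p x t)\<close>.\<close>
  define v where "v x t = t *\<^sub>R \<omega>' (p x t) (x - x0) + \<omega> (p x t)" for x t
  define f where "f x = c + integral (cbox 0 1) (\<lambda>t. \<omega> (p x t) \<bullet> (x - x0))" for x
  have cont\<omega>: "continuous_on (ball x0 r) \<omega>"
    using der by (meson continuous_at_imp_continuous_on has_derivative_continuous)
  have cp: "continuous_on A (\<lambda>z. p (fst z) (snd z))" for A
    unfolding p_def by (intro continuous_intros)
  have cw: "continuous_on (ball x0 r \<times> {0..1}) (\<lambda>z. \<omega> (p (fst z) (snd z)))"
    by (rule continuous_on_compose2[OF cont\<omega> cp]) (auto simp del: mem_ball intro!: p)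
  have cw': "continuous_on (ball x0 r \<times> {0..1}) (\<lambda>z. \<omega>' (p (fst z) (snd z)) (fst z - x0))"
  proof -
    have "continuous_on (ball x0 r \<times> {0..1})
        (\<lambda>z. (\<lambda>(x, h). \<omega>' x h) (p (fst z) (snd z), fst z - x0))"
      by (rule continuous_on_compose2[OF cont])
        (auto simp del: mem_ball intro!: p continuous_intros cp)
    then show ?thesis by simp
  qed
  have FTC: "(v x has_integral \<omega> x) {0..1}" if x: "x \<in> ball x0 r" for x
  proof -
    have "((\<lambda>t. t *\<^sub>R \<omega> (p x t)) has_vector_derivative v x t) (at t within {0..1})"
      if t: "t \<in> {0..1}" for t
    proof -
      have "((\<lambda>t. p x t) has_derivative (\<lambda>d. d *\<^sub>R (x - x0))) (at t within {0..1})"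
        unfolding p_def by (auto intro!: derivative_eq_intros)
      from has_derivative_compose[OF this der[OF p[OF x t]]]
      have "((\<lambda>t. \<omega> (p x t)) has_derivative (\<lambda>d. \<omega>' (p x t) (d *\<^sub>R (x - x0)))) (at t within {0..1})" .
      then have "((\<lambda>t. \<omega> (p x t)) has_derivative (\<lambda>d. d *\<^sub>R \<omega>' (p x t) (x - x0))) (at t within {0..1})"
        by (simp only: linear_scale[OF has_derivative_linear[OF der[OF p[OF x t]]]])
      from has_derivative_scaleR[OF has_derivative_ident this] show ?thesis
        unfolding has_vector_derivative_def v_def
        by (simp add: scaleR_right_distrib mult.commute add.commute)
    qed
    from fundamental_theorem_of_calculus[OF _ this] show ?thesis by (simp add: p_def)
  qed
  have "(f has_derivative (\<lambda>h. \<omega> x \<bullet> h)) (at x)" if x: "x \<in> ball x0 r" for x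
  proof -
    \<comment> \<open>The Leibniz rule takes derivatives as elements of the space of bounded linear
      maps; \<open>blinfun_inner_left\<close> turns the vector \<open>v x t\<close> into the
      functional of inner multiplication by it.\<close>
    have "((\<lambda>x. integral (cbox 0 1) (\<lambda>t. \<omega> (p x t) \<bullet> (x - x0))) has_derivative
        integral (cbox 0 1) (\<lambda>t. blinfun_inner_left (v x t))) (at x within ball x0 r)"
    proof (rule leibniz_rule)
      fix y and t :: real assume y: "y \<in> ball x0 r" and "t \<in> cbox 0 1"
      then have t: "t \<in> {0..1}" by simp
      have "((\<lambda>y. p y t) has_derivative (\<lambda>h. t *\<^sub>R h)) (at y within ball x0 r)"
        unfolding p_def by (auto intro!: derivative_eq_intros)
      from has_derivative_compose[OF this der[OF p[OF y t]]]
      have "((\<lambda>y. \<omega> (p y t)) has_derivative (\<lambda>h. \<omega>' (p y t) (t *\<^sub>R h))) (at y within ball x0 r)" .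
      moreover have "((\<lambda>y. y - x0) has_derivative (\<lambda>h. h)) (at y within ball x0 r)"
        by (auto intro!: derivative_eq_intros)
      ultimately have "((\<lambda>y. \<omega> (p y t) \<bullet> (y - x0)) has_derivative
          (\<lambda>h. \<omega> (p y t) \<bullet> h + \<omega>' (p y t) (t *\<^sub>R h) \<bullet> (y - x0))) (at y within ball x0 r)"
        by (rule has_derivative_inner)
      \<comment> \<open>Here symmetry enters: it swaps the increment \<open>h\<close> with
        \<open>y - x0\<close>, so that the derivative becomes the inner product of \<open>h\<close>
        with one vector, \<open>v y t\<close>.\<close>
      moreover have "\<omega> (p y t) \<bullet> h + \<omega>' (p y t) (t *\<^sub>R h) \<bullet> (y - x0) = h \<bullet> v y t" for h
        using sym[OF p[OF y t], of h "y - x0"]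
        by (simp add: v_def linear_scale[OF has_derivative_linear[OF der[OF p[OF y t]]]]
            inner_commute algebra_simps)
      ultimately show "((\<lambda>x. \<omega> (p x t) \<bullet> (x - x0)) has_derivative
          blinfun_apply (blinfun_inner_left (v y t))) (at y within ball x0 r)"
        by (simp add: blinfun_inner_left.rep_eq)
    next
      fix y assume y: "y \<in> ball x0 r"
      have "continuous_on {0..1} (p y)" unfolding p_def by (intro continuous_intros)
      then have "continuous_on {0..1} (\<lambda>t. \<omega> (p y t) \<bullet> (y - x0))"
        using p[OF y] by (intro continuous_intros continuous_on_compose2[OF cont\<omega>]) auto
      then show "(\<lambda>t. \<omega> (p y t) \<bullet> (y - x0)) integrable_on cbox 0 1"
        by (simp add: integrable_continuous_interval)
    next
      have "continuous_on (ball x0 r \<times> {0..1}) (\<lambda>z. v (fst z) (snd z))"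
        unfolding v_def by (intro continuous_intros cw cw')
      from bounded_linear.continuous_on[OF bounded_linear_blinfun_inner_left this]
      show "continuous_on (ball x0 r \<times> cbox 0 1) (\<lambda>(x, t). blinfun_inner_left (v x t))"
        by (simp add: case_prod_beta)
    qed (use x in auto)
    moreover have "integral (cbox 0 1) (\<lambda>t. blinfun_inner_left (v x t)) = blinfun_inner_left (\<omega> x)"
      using has_integral_linear[OF FTC[OF x] bounded_linear_blinfun_inner_left]
      by (simp add: o_def integral_unique)
    ultimately have "((\<lambda>x. integral (cbox 0 1) (\<lambda>t. \<omega> (p x t) \<bullet> (x - x0))) has_derivative
        (\<lambda>h. \<omega> x \<bullet> h)) (at x)"
      using x by (simp add: at_within_open[OF _ open_ball] inner_commute blinfun_inner_left.rep_eq)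
    from has_derivative_add[OF has_derivative_const this] show ?thesis by (simp add: f_def[abs_def])
  qed
  moreover have "f x0 = c" by (simp add: f_def)
  ultimately show ?thesis using that by blast
qed

text \<open>Picard iteration in the supremum norm. Each step must find a function with prescribed
  gradient, which is not automatic in several variables; \<open>P\<close> is the invariant of the
  iterates that makes it possible. The bound on \<open>M * r\<close> keeps the iterates within
  \<open>e\<close> of \<open>z0\<close>, the bound on \<open>L * r\<close> makes them
  contract.\<close>

lemma gradient_equation_exists_by_iteration:
  fixes F :: "'a::euclidean_space \<Rightarrow> real \<Rightarrow> 'a"
  assumes "r > 0" and e: "e \<ge> 0" and "L \<ge> 0"
    and bound: "\<And>x z. x \<in> ball x0 r \<Longrightarrow> \<bar>z - z0\<bar> \<le> e \<Longrightarrow> norm (F x z) \<le> M"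
    and lip: "\<And>x z w. x \<in> ball x0 r \<Longrightarrow> \<bar>z - z0\<bar> \<le> e \<Longrightarrow> \<bar>w - z0\<bar> \<le> e \<Longrightarrow>
      norm (F x z - F x w) \<le> L * \<bar>z - w\<bar>"
    and small: "M * r \<le> e" "L * r \<le> 1 / 2"
    and start: "P (\<lambda>_. z0)"
    and step: "\<And>u. P u \<Longrightarrow> (\<And>x. x \<in> ball x0 r \<Longrightarrow> \<bar>u x - z0\<bar> \<le> e) \<Longrightarrow>
      \<exists>v. P v \<and> v x0 = z0 \<and>
        (\<forall>x\<in>ball x0 r. (v has_derivative (\<lambda>h. F x (u x) \<bullet> h)) (at x))"
  obtains z where "z x0 = z0"
    "\<And>x. x \<in> ball x0 r \<Longrightarrow> \<bar>z x - z0\<bar> \<le> e"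
    "\<And>x. x \<in> ball x0 r \<Longrightarrow> (z has_derivative (\<lambda>h. F x (z x) \<bullet> h)) (at x)"
proof -
  let ?B = "ball x0 r"
  have x0: "x0 \<in> ?B" using \<open>r > 0\<close> by simp
  \<comment> \<open>Mean value inequality relative to the centre, where all iterates take the value
    \<open>z0\<close>.\<close>
  have mvt: "\<bar>f x - f x0\<bar> \<le> K * r"
    if "\<And>x. x \<in> ?B \<Longrightarrow> (f has_derivative (\<lambda>h. G x \<bullet> h)) (at x)" "\<And>x. x \<in> ?B \<Longrightarrow> norm (G x) \<le> K"
      "x \<in> ?B" for f :: "'a \<Rightarrow> real" and G K x
  proof -
    have K: "K \<ge> 0" using that(2)[OF x0] norm_ge_zero order_trans by blast
    have "onorm (\<lambda>h. G y \<bullet> h) \<le> K" if y: "y \<in> ?B" for y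
    proof (rule onorm_bound[OF K])
      fix h
      have "norm (G y \<bullet> h) \<le> norm (G y) * norm h" by (simp add: Cauchy_Schwarz_ineq2)
      also have "\<dots> \<le> K * norm h" using \<open>\<And>x. x \<in> ?B \<Longrightarrow> norm (G x) \<le> K\<close>[OF y] by (simp add: mult_right_mono)
      finally show "norm (G y \<bullet> h) \<le> K * norm h" .
    qed
    from differentiable_bound[OF convex_ball has_derivative_at_withinI[OF that(1)] this that(3) x0]
    have "norm (f x - f x0) \<le> K * norm (x - x0)" by blast
    also have "\<dots> \<le> K * r" using that(3) K
      by (intro mult_left_mono) (auto simp: dist_norm norm_minus_commute)
    finally show ?thesis by simp
  qed
  define Q where "Q u \<longleftrightarrow> P u \<and> u x0 = z0 \<and> (\<forall>x\<in>?B. \<bar>u x - z0\<bar> \<le> e)" for u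
  have Q0: "Q (\<lambda>_. z0)" using start e by (simp add: Q_def)
  have Qstep: "\<exists>v. Q v \<and> (\<forall>x\<in>?B. (v has_derivative (\<lambda>h. F x (u x) \<bullet> h)) (at x))" if "Q u" for u
  proof -
    obtain v where v: "P v" "v x0 = z0"
      "\<And>x. x \<in> ?B \<Longrightarrow> (v has_derivative (\<lambda>h. F x (u x) \<bullet> h)) (at x)"
      using step[of u] \<open>Q u\<close> unfolding Q_def by blast
    have "\<bar>v x - v x0\<bar> \<le> M * r" if "x \<in> ?B" for x
      by (rule mvt[OF v(3) bound that]) (use \<open>Q u\<close> in \<open>auto simp: Q_def\<close>)
    then have "Q v" using v(1,2) small(1) unfolding Q_def by force
    then show ?thesis using v(3) by blast
  qed
  \<comment> \<open>Dependent choice, because the link between consecutive iterates has to be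
    recorded along with the invariant.\<close>
  have "\<exists>u. \<forall>n. Q (u n) \<and> (\<forall>x\<in>?B. (u (Suc n) has_derivative (\<lambda>h. F x (u n x) \<bullet> h)) (at x))"
    by (rule dependent_nat_choice) (use Q0 Qstep in blast)+
  then obtain u where u: "\<And>n. Q (u n)"
    "\<And>n x. x \<in> ?B \<Longrightarrow> (u (Suc n) has_derivative (\<lambda>h. F x (u n x) \<bullet> h)) (at x)"
    by blast
  have ue: "\<bar>u n x - z0\<bar> \<le> e" "u n x0 = z0" if "x \<in> ?B" for n x
    using u(1)[of n] that by (auto simp: Q_def)
  \<comment> \<open>The induction starts from two functions within \<open>e\<close> of
    \<open>z0\<close>. The gradient of the next difference is at most \<open>L\<close> times the
    present one, and the difference vanishes at \<open>x0\<close>, so passing to values costs a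
    factor \<open>r\<close>; together \<open>L * r\<close> halves the bound.\<close>
  have contr: "\<bar>u (Suc n) x - u n x\<bar> \<le> 2 * e * (1/2) ^ n" if "x \<in> ?B" for n x
    using that
  proof (induction n arbitrary: x)
    case 0
    then show ?case using ue(1)[OF 0, of 0] ue(1)[OF 0, of 1] by simp
  next
    case (Suc n)
    have "\<bar>(u (Suc (Suc n)) x - u (Suc n) x) - (u (Suc (Suc n)) x0 - u (Suc n) x0)\<bar>
        \<le> (L * (2 * e * (1/2) ^ n)) * r"
    proof (rule mvt[OF _ _ Suc.prems])
      fix y assume y: "y \<in> ?B"
      show "((\<lambda>x. u (Suc (Suc n)) x - u (Suc n) x) has_derivative
          (\<lambda>h. (F y (u (Suc n) y) - F y (u n y)) \<bullet> h)) (at y)"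
        using has_derivative_diff[OF u(2)[OF y, of "Suc n"] u(2)[OF y, of n]]
        by (simp add: inner_diff_left)
      show "norm (F y (u (Suc n) y) - F y (u n y)) \<le> L * (2 * e * (1/2) ^ n)"
        using lip[OF y ue(1)[OF y, of "Suc n"] ue(1)[OF y, of n]]
          mult_left_mono[OF Suc.IH[OF y] \<open>L \<ge> 0\<close>] by linarith
    qed
    also have "\<dots> = (L * r) * (2 * e * (1/2) ^ n)" by simp
    also have "\<dots> \<le> (1/2) * (2 * e * (1/2) ^ n)"
      using small(2) e by (intro mult_right_mono) auto
    finally show ?case using ue(2)[OF Suc.prems] by simp
  qed
  \<comment> \<open>The two \<open>z0\<close> cancel: this is \<open>u 0\<close> plus the
    telescoping series of increments, which has a geometric majorant and hence converges
    uniformly.\<close>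
  define z where "z x = z0 + (\<Sum>i. u (Suc i) x - u i x) + (u 0 x - z0)" for x
  have "uniform_limit ?B (\<lambda>n x. \<Sum>i<n. u (Suc i) x - u i x) (\<lambda>x. \<Sum>i. u (Suc i) x - u i x) sequentially"
    by (rule Weierstrass_m_test[of _ _ "\<lambda>n. 2 * e * (1/2) ^ n"])
      (use contr in \<open>auto intro: summable_mult summable_geometric\<close>)
  moreover have "(\<Sum>i<n. u (Suc i) x - u i x) = u n x - u 0 x" for n x
    by (rule sum_lessThan_telescope)
  ultimately have unif: "uniform_limit ?B u z sequentially"
    unfolding uniform_limit_iff z_def by (simp add: dist_norm algebra_simps)
  have lim: "(\<lambda>n. u n x) \<longlonglongrightarrow> z x" if "x \<in> ?B" for x
    using tendsto_uniform_limitI[OF unif that] .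
  have ze: "\<bar>z x - z0\<bar> \<le> e" if "x \<in> ?B" for x
    by (rule Lim_bounded[OF tendsto_rabs[OF tendsto_diff[OF lim[OF that] tendsto_const]], of 0])
      (use ue(1)[OF that] in auto)
  \<comment> \<open>Uniform convergence of the gradients allows differentiating the limit. The
    sequence is shifted because \<open>u (Suc n)\<close> has the gradient
    \<open>F x (u n x)\<close>; the limit \<open>g\<close> supplied here is identified with
    \<open>z\<close> afterwards.\<close>
  have "\<exists>g. \<forall>x\<in>?B. (\<lambda>n. u (Suc n) x) \<longlonglongrightarrow> g x \<and> (g has_derivative (\<lambda>h. F x (z x) \<bullet> h)) (at x within ?B)"
  proof (rule has_derivative_sequence[where f' = "\<lambda>n x h. F x (u n x) \<bullet> h"])
    show "convex ?B" "x0 \<in> ?B" using x0 by simp_all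
    show "(u (Suc n) has_derivative (\<lambda>h. F x (u n x) \<bullet> h)) (at x within ?B)" if "x \<in> ?B" for n x
      using u(2)[OF that] by (rule has_derivative_at_withinI)
    show "(\<lambda>n. u (Suc n) x0) \<longlonglongrightarrow> z x0" using lim[OF x0] by (rule LIMSEQ_Suc)
    fix d :: real assume d: "d > 0"
    \<comment> \<open>The denominator is \<open>L + 1\<close> because \<open>L\<close> may be
      zero.\<close>
    then have "\<forall>\<^sub>F n in sequentially. \<forall>x\<in>?B. dist (u n x) (z x) < d / (L + 1)"
      using unif \<open>L \<ge> 0\<close> by (auto simp: uniform_limit_iff)
    then show "\<forall>\<^sub>F n in sequentially. \<forall>x\<in>?B. \<forall>h. norm (F x (u n x) \<bullet> h - F x (z x) \<bullet> h) \<le> d * norm h"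
    proof (rule eventually_mono, intro ballI allI)
      fix n x and h :: 'a assume *: "\<forall>x\<in>?B. dist (u n x) (z x) < d / (L + 1)" and x: "x \<in> ?B"
      have "norm (F x (u n x) - F x (z x)) \<le> L * \<bar>u n x - z x\<bar>"
        using lip[OF x ue(1)[OF x] ze[OF x]] .
      also have "\<dots> \<le> (L + 1) * (d / (L + 1))"
        using *[rule_format, OF x] \<open>L \<ge> 0\<close> by (intro mult_mono) (auto simp: dist_real_def)
      also have "\<dots> = d" using \<open>L \<ge> 0\<close> by simp
      finally have "norm (F x (u n x) - F x (z x)) * norm h \<le> d * norm h" by (simp add: mult_right_mono)
      then show "norm (F x (u n x) \<bullet> h - F x (z x) \<bullet> h) \<le> d * norm h"
        using Cauchy_Schwarz_ineq2[of "F x (u n x) - F x (z x)" h] by (simp add: inner_diff_left)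
    qed
  qed
  then obtain g where g: "\<And>x. x \<in> ?B \<Longrightarrow> (\<lambda>n. u (Suc n) x) \<longlonglongrightarrow> g x"
    "\<And>x. x \<in> ?B \<Longrightarrow> (g has_derivative (\<lambda>h. F x (z x) \<bullet> h)) (at x within ?B)" by blast
  have gz: "g x = z x" if "x \<in> ?B" for x
    using LIMSEQ_unique[OF g(1)[OF that] LIMSEQ_Suc[OF lim[OF that]]] .
  show ?thesis
  proof (rule that)
    show "z x0 = z0" using LIMSEQ_unique[OF lim[OF x0]] ue(2)[OF x0] by simp
    show "\<bar>z x - z0\<bar> \<le> e" if "x \<in> ?B" for x using ze[OF that] .
    show "(z has_derivative (\<lambda>h. F x (z x) \<bullet> h)) (at x)" if x: "x \<in> ?B" for x
    proof -
      have "(g has_derivative (\<lambda>h. F x (z x) \<bullet> h)) (at x)"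
        using g(2)[OF x] x by (simp add: at_within_open[OF _ open_ball])
      then show ?thesis by (rule has_derivative_transform_within_open[OF _ open_ball x gz])
    qed
  qed
qed

subsection \<open>Snell's law and Malus' theorem\<close>

lemma pt3_nth [simp]: "pt3 v t $ 1 = v $ 1" "pt3 v t $ 2 = v $ 2" "pt3 v t $ 3 = t"
  by (simp_all add: pt3_def)

lemma pt3_add: "pt3 u s + pt3 v t = pt3 (u + v) (s + t)"
  and pt3_diff: "pt3 u s - pt3 v t = pt3 (u - v) (s - t)"
  and pt3_scaleR: "r *\<^sub>R pt3 v t = pt3 (r *\<^sub>R v) (r * t)"
  and inner_pt3: "pt3 u s \<bullet> pt3 v t = u \<bullet> v + s * t"
  and vertical_eq_pt3: "vertical = pt3 0 1"
  and pt3_eq_iff: "pt3 u s = pt3 v t \<longleftrightarrow> u = v \<and> s = t"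
  by (auto simp: vec_eq_iff forall_3 forall_2 inner_vec_def sum_3 sum_2 vertical_def)

lemma norm_pt3: "norm (pt3 v t) = sqrt ((norm v)\<^sup>2 + t\<^sup>2)"
  by (simp add: norm_eq_sqrt_inner inner_pt3 power2_eq_square)

text \<open>Since \<open>D + d = \<kappa> * z\<close>, adding \<open>D / d\<close> times the
  unnormalised normal with horizontal part \<open>(\<kappa> / D) *\<^sub>R v\<close> and height 1 to
  the vertical vector gives \<open>\<kappa> / d\<close> times \<open>pt3 v z\<close>. What remains
  is to see that Snell's law prescribes exactly this multiple of the normal.\<close>

lemma refracted_dir_eq:
  assumes "\<kappa> > 0" "z > 0"
    and d: "d = sqrt ((norm v)\<^sup>2 + z\<^sup>2)"
    and D: "D = \<kappa> * z - d" "D > 0"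
    and grad: "grad \<rho> x = - (\<kappa> / D) *\<^sub>R v"
  shows "refracted_dir \<kappa> \<rho> x = pt3 (v /\<^sub>R d) (z / d)"
proof -
  define s where "s = (norm v)\<^sup>2"
  define N where "N = sqrt (1 + (\<kappa> / D)\<^sup>2 * s)"
  have s: "s \<ge> 0" by (simp add: s_def)
  have d2: "d\<^sup>2 = s + z\<^sup>2" using s by (simp add: d s_def)
  have dpos: "d > 0" using \<open>z > 0\<close> by (simp add: d sum_power2_gt_zero_iff add_nonneg_pos)
  have N2: "N\<^sup>2 = 1 + (\<kappa> / D)\<^sup>2 * s" using s by (simp add: N_def)
  have Npos: "N > 0" using s by (simp add: N_def add_pos_nonneg)
  have \<nu>: "unit_normal \<rho> x = pt3 ((\<kappa> / (D * N)) *\<^sub>R v) (1 / N)"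
    using \<open>\<kappa> > 0\<close> \<open>D > 0\<close>
    by (simp add: unit_normal_def grad pt3_scaleR pt3_eq_iff N_def s_def power_mult_distrib
        divide_inverse mult.commute mult.left_commute)
  have DN: "D\<^sup>2 * N\<^sup>2 = D\<^sup>2 + \<kappa>\<^sup>2 * s"
    using \<open>D > 0\<close> by (simp add: N2 field_simps)
  \<comment> \<open>The expected value of the root in Snell's law is squared; \<open>D > 0\<close>
    makes it positive, hence the principal root.\<close>
  have "(1 / N + D * N / d)\<^sup>2 = (1 / N)\<^sup>2 + (2 * D * d + D\<^sup>2 * N\<^sup>2) / d\<^sup>2"
    using Npos dpos by (simp add: field_simps power2_eq_square)
  also have "2 * D * d + D\<^sup>2 * N\<^sup>2 = (\<kappa>\<^sup>2 - 1) * d\<^sup>2"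
  proof -
    have "2 * D * d + D\<^sup>2 + d\<^sup>2 = (\<kappa> * z)\<^sup>2" by (simp add: D(1) power2_eq_square algebra_simps)
    then show ?thesis unfolding DN using d2 by (simp add: algebra_simps power_mult_distrib)
  qed
  finally have "(1 / N + D * N / d)\<^sup>2 = \<kappa>\<^sup>2 - 1 + (1 / N)\<^sup>2" using dpos by simp
  then have root: "sqrt (\<kappa>\<^sup>2 - 1 + (1 / N)\<^sup>2) = 1 / N + D * N / d"
    using Npos dpos \<open>D > 0\<close> by (intro real_sqrt_unique) auto
  have e: "vertical \<bullet> unit_normal \<rho> x = 1 / N" by (simp add: \<nu> vertical_eq_pt3 inner_pt3)
  have "refracted_dir \<kappa> \<rho> x = (1 / \<kappa>) *\<^sub>R (vertical + (D * N / d) *\<^sub>R unit_normal \<rho> x)"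
    by (simp add: refracted_dir_def Let_def e root)
  also have "\<dots> = pt3 ((1 / \<kappa> * (D * N / d) * (\<kappa> / (D * N))) *\<^sub>R v) (1 / \<kappa> * (1 + D * N / d * (1 / N)))"
    by (simp add: \<nu> vertical_eq_pt3 pt3_scaleR pt3_add)
  also have "1 / \<kappa> * (D * N / d) * (\<kappa> / (D * N)) = inverse d"
    using \<open>\<kappa> > 0\<close> \<open>D > 0\<close> Npos by (simp add: field_simps)
  also have "1 / \<kappa> * (1 + D * N / d * (1 / N)) = z / d"
    using \<open>\<kappa> > 0\<close> Npos dpos D(1) by (simp add: field_simps)
  finally show ?thesis .
qed

lemma refracts_into_if_grad:
  assumes "\<kappa> > 0" "0 < \<rho> x" "\<rho> x < a"
    and "D = \<kappa> * (a - \<rho> x) - sqrt ((norm (y - x))\<^sup>2 + (a - \<rho> x)\<^sup>2)" "D > 0"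
    and "grad \<rho> x = - (\<kappa> / D) *\<^sub>R (y - x)"
  shows "refracts_into \<kappa> \<rho> a x y"
  using refracted_dir_eq[OF assms(1) _ refl assms(4-6)] assms(2,3)
  by (simp add: refracts_into_def pt3_diff norm_pt3 pt3_scaleR divide_inverse mult.commute)

text \<open>A phase gradient equal to \<open>k\<close> times the tangential part of the ray cancels
  that part. The remaining vector is vertical, so the radicand is the square of
  \<open>\<kappa>\<^sub>2\<close> and \<mu> equals \<open>t - \<kappa>\<^sub>2\<close>.\<close>

lemma metasurface_refracts_vertically_intoI:
  assumes "k > 0" "\<kappa>\<^sub>2 > 0" "a < c" "grad \<phi> (pt3 y a) = pt3 (k *\<^sub>R v) 0"
  shows "metasurface_refracts_vertically_into k \<kappa>\<^sub>2 \<phi> (pt3 v t) y a c"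
proof -
  have q: "pt3 v t - (1 / k) *\<^sub>R grad \<phi> (pt3 y a) = pt3 0 t"
    using assms by (simp add: pt3_scaleR pt3_diff)
  have "\<exists>s>0. pt3 y c = pt3 y a + s *\<^sub>R vertical"
    by (rule exI[of _ "c - a"]) (use assms in \<open>simp add: vertical_eq_pt3 pt3_scaleR pt3_add\<close>)
  then show ?thesis
    unfolding metasurface_refracts_vertically_into_def Let_def q
    using assms by (simp add: vertical_eq_pt3 pt3_scaleR pt3_diff norm_pt3)
qed

text \<open>Malus' theorem: the optical path length \<open>\<rho> + \<kappa> d\<close> up to the metasurface, as a function of
  the target \<open>T x\<close>, has the horizontal part \<open>\<kappa> S / d\<close> of the ray direction as its gradient.\<close>

lemma has_derivative_optical_path:
  fixes S T :: "'a::real_inner \<Rightarrow> 'a" and z :: "'a \<Rightarrow> real"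
  assumes S: "(S has_derivative S') (at x)"
    and z: "(z has_derivative (\<lambda>h. ((\<kappa> / (\<kappa> * z x - d)) *\<^sub>R S x) \<bullet> h)) (at x)"
    and d: "d = sqrt ((norm (S x))\<^sup>2 + (z x)\<^sup>2)" and "z x > 0" "\<kappa> * z x - d \<noteq> 0"
  shows "((\<lambda>x. a - z x + \<kappa> * sqrt ((norm (S x))\<^sup>2 + (z x)\<^sup>2)) has_derivative
      (\<lambda>h. ((\<kappa> / d) *\<^sub>R S x) \<bullet> (h + S' h))) (at x)"
proof -
  let ?z' = "\<lambda>h. ((\<kappa> / (\<kappa> * z x - d)) *\<^sub>R S x) \<bullet> h"
  have pos: "S x \<bullet> S x + z x * z x > 0" using \<open>z x > 0\<close> by (simp add: add_nonneg_pos)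
  have d': "d = sqrt (S x \<bullet> S x + z x * z x)" by (simp add: d power2_norm_eq_inner power2_eq_square[of "z x"])
  have dpos: "d > 0" using pos by (simp add: d')
  have "((\<lambda>x. a - z x + \<kappa> * sqrt (S x \<bullet> S x + z x * z x)) has_derivative
      (\<lambda>h. 0 - ?z' h + \<kappa> * ((S x \<bullet> S' h + S' h \<bullet> S x + (z x * ?z' h + ?z' h * z x)) *
        (inverse d / 2)))) (at x)"
    unfolding d'
    by (intro has_derivative_add has_derivative_diff has_derivative_const has_derivative_mult_right
        has_derivative_real_sqrt has_derivative_inner has_derivative_mult S z[unfolded d'] pos)
  moreover have "0 - ?z' h + \<kappa> * ((S x \<bullet> S' h + S' h \<bullet> S x + (z x * ?z' h + ?z' h * z x)) *
        (inverse d / 2)) = ((\<kappa> / d) *\<^sub>R S x) \<bullet> (h + S' h)" for h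
  proof -
    \<comment> \<open>The equation for \<open>z\<close> in product form. The terms containing
      \<open>?z'\<close> collect into this left-hand side divided by \<open>d\<close>, so the
      equation turns them into the part of the claim that is linear in \<open>h\<close>
      alone.\<close>
    have w: "?z' h * (\<kappa> * z x - d) = \<kappa> * (S x \<bullet> h)" using assms(5) by simp
    have "0 - w + \<kappa> * ((b + b + (z x * w + w * z x)) * (inverse d / 2)) =
        (w * (\<kappa> * z x - d) + \<kappa> * b) / d" for w b :: real
      using dpos by (simp add: field_simps)
    then show ?thesis
      by (simp only: w inner_commute[of "S' h" "S x"])
        (simp add: inner_add_right add_divide_distrib distrib_left)
  qed
  ultimately show ?thesis by (simp add: power2_norm_eq_inner power2_eq_square[of "z _"])
qed

subsection \<open>The refraction equation\<close>

lemma jacobian_nth: "jacobian F (at x) $ i $ j = partial j F x $ i"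
  by (simp add: jacobian_def matrix_def partial_def)

lemma Ck_on_nth: "open U \<Longrightarrow> Ck_on k f U \<Longrightarrow> Ck_on k (\<lambda>x. f x $ i) U"
  by (rule Ck_on_bounded_linear[OF _ bounded_linear_vec_nth])

lemma curl_free_field_has_potential:
  assumes "Ck_on 1 \<omega> (ball x0 r)" "\<And>x. x \<in> ball x0 r \<Longrightarrow> curl2 \<omega> x = 0"
  obtains f where "f x0 = c" "\<And>x. x \<in> ball x0 r \<Longrightarrow> (f has_derivative (\<lambda>h. \<omega> x \<bullet> h)) (at x)"
proof (rule closed_field_has_potential)
  show "(\<omega> has_derivative (\<lambda>h. \<Sum>j\<in>UNIV. h $ j *\<^sub>R partial j \<omega> x)) (at x)" if "x \<in> ball x0 r" for x
    using assms(1) that by (intro has_derivative_partials) simp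
  have c: "continuous_on (ball x0 r \<times> UNIV) (\<lambda>z. partial j \<omega> (fst z))" for j
    using assms(1) by (intro continuous_on_compose2[OF _ continuous_on_fst[OF continuous_on_id], of "ball x0 r"]) auto
  show "continuous_on (ball x0 r \<times> UNIV) (\<lambda>(x, h). \<Sum>j\<in>UNIV. h $ j *\<^sub>R partial j \<omega> x)"
    unfolding case_prod_beta by (intro continuous_intros c)
  \<comment> \<open>In the plane, symmetry of the derivative means equality of its two off-diagonal
    entries, that is, vanishing curl.\<close>
  show "(\<Sum>j\<in>UNIV. h $ j *\<^sub>R partial j \<omega> x) \<bullet> l = (\<Sum>j\<in>UNIV. l $ j *\<^sub>R partial j \<omega> x) \<bullet> h"
    if "x \<in> ball x0 r" for x h l
    using assms(2)[OF that]
    by (simp add: curl2_def jacobian_nth sum_2 inner_vec_def algebra_simps)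
qed (use that in blast)+

text \<open>For curl-free \<open>S\<close> this reduces closedness of a multiple of \<open>S\<close>
  to the gradient of the coefficient being parallel to \<open>S\<close>.\<close>

lemma curl2_scaleR:
  assumes "g differentiable (at x)" "S differentiable (at x)"
  shows "curl2 (\<lambda>x. g x *\<^sub>R S x) x = g x * curl2 S x - cross2 (S x) (grad g x)"
proof -
  have "partial j (\<lambda>x. g x *\<^sub>R S x) x = g x *\<^sub>R partial j S x + partial j g x *\<^sub>R S x" for j
    using partial_eqI[OF has_derivative_scaleR[OF frechet_has_derivative[OF assms(1)]
          frechet_has_derivative[OF assms(2)]]] by (simp add: partial_def)
  then show ?thesis
    by (simp add: curl2_def jacobian_nth cross2_def grad_def algebra_simps)
qed

lemma Ck_on_norm_square:
  fixes S :: "real^'n \<Rightarrow> real^'m"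
  assumes "open U" "Ck_on k S U"
  shows "Ck_on k (\<lambda>x. (norm (S x))\<^sup>2) U"
proof -
  have "Ck_on k (\<lambda>x. \<Sum>i\<in>A. S x $ i * S x $ i) U" if "finite A" for A
    using that
    by induction (auto intro!: Ck_on_const Ck_on_add Ck_on_mult Ck_on_nth assms)
  from this[OF finite_class.finite_UNIV] show ?thesis
    unfolding power2_norm_eq_inner inner_vec_def by (simp del: inner_real_def add: inner_real_def)
qed

text \<open>With \<open>z = a - \<rho>\<close> this is minus the denominator of the equation; the
  sign makes it positive for admissible heights.\<close>

definition snell_denom :: "real \<Rightarrow> real^2 \<Rightarrow> real \<Rightarrow> real" where
  "snell_denom \<kappa> v z = \<kappa> * z - sqrt ((norm v)\<^sup>2 + z\<^sup>2)"

lemma Ck_on_snell_coefficient: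
  assumes "open U" "Ck_on k S U" "Ck_on k z U"
    and "\<And>x. x \<in> U \<Longrightarrow> z x > 0" "\<And>x. x \<in> U \<Longrightarrow> snell_denom \<kappa> (S x) (z x) > 0"
  shows "Ck_on k (\<lambda>x. \<kappa> / snell_denom \<kappa> (S x) (z x)) U"
proof -
  have "Ck_on k (\<lambda>x. sqrt ((norm (S x))\<^sup>2 + z x * z x)) U"
    using assms(4) by (intro Ck_on_sqrt Ck_on_add Ck_on_norm_square Ck_on_mult assms(1-3))
      (simp add: add_nonneg_pos)
  then have "Ck_on k (\<lambda>x. snell_denom \<kappa> (S x) (z x)) U"
    unfolding snell_denom_def power2_eq_square[of "z _"]
    by (intro Ck_on_diff Ck_on_mult Ck_on_const assms(1,3))
  then have "Ck_on k (\<lambda>x. inverse (snell_denom \<kappa> (S x) (z x))) U"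
    using assms(5) by (intro Ck_on_inverse assms(1)) force
  then show ?thesis
    unfolding divide_inverse by (intro Ck_on_mult Ck_on_const assms(1))
qed

lemma cross2_grad_snell_coefficient:
  assumes "S differentiable (at x)" "u differentiable (at x)"
    and "cross2 (S x) (grad (\<lambda>y. (norm (S y))\<^sup>2) x) = 0" "cross2 (S x) (grad u x) = 0"
    and "u x > 0" "snell_denom \<kappa> (S x) (u x) > 0"
  shows "cross2 (S x) (grad (\<lambda>x. \<kappa> / snell_denom \<kappa> (S x) (u x)) x) = 0"
proof -
  let ?s = "\<lambda>y. (norm (S y))\<^sup>2"
  define d where "d = sqrt ((norm (S x))\<^sup>2 + (u x)\<^sup>2)"
  define D where "D = snell_denom \<kappa> (S x) (u x)"
  obtain S' where S': "(S has_derivative S') (at x)"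
    using assms(1) unfolding differentiable_def by blast
  have "?s differentiable (at x)"
    using has_derivative_inner[OF S' S'] unfolding differentiable_def power2_norm_eq_inner by blast
  note ds = has_derivative_grad[OF this] and du = has_derivative_grad[OF assms(2)]
  have "(norm (S x))\<^sup>2 + (u x)\<^sup>2 > 0" using \<open>u x > 0\<close> by (simp add: add_nonneg_pos)
  then have pos: "(norm (S x))\<^sup>2 + u x * u x > 0" by (simp add: power2_eq_square[of "u x"])
  have "((\<lambda>x. snell_denom \<kappa> (S x) (u x)) has_derivative
      (\<lambda>h. \<kappa> * (grad u x \<bullet> h) - (grad ?s x \<bullet> h + (u x * (grad u x \<bullet> h) + (grad u x \<bullet> h) * u x)) *
        (inverse d / 2))) (at x)"
    unfolding snell_denom_def d_def power2_eq_square[of "u _"]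
    by (intro has_derivative_diff has_derivative_mult_right has_derivative_real_sqrt
        has_derivative_add has_derivative_mult ds du pos)
  note dD = this
  have "D \<noteq> 0" using assms(6) by (simp add: D_def)
  from has_derivative_mult_right[OF Deriv.has_derivative_inverse[OF this[unfolded D_def] dD], of \<kappa>]
  have dcoeff: "((\<lambda>x. \<kappa> / snell_denom \<kappa> (S x) (u x)) has_derivative
      (\<lambda>h. \<kappa> * - (inverse D * (\<kappa> * (grad u x \<bullet> h) -
        (grad ?s x \<bullet> h + (u x * (grad u x \<bullet> h) + (grad u x \<bullet> h) * u x)) * (inverse d / 2)) *
          inverse D))) (at x)"
    unfolding D_def divide_inverse[of \<kappa>] .
  \<comment> \<open>The partial derivatives of the coefficient with respect to the squared norm of
    \<open>S\<close> and to \<open>u\<close>. The gradients they multiply are both parallel to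
    \<open>S\<close> by assumption.\<close>
  define \<alpha> \<beta> where "\<alpha> = \<kappa> * inverse D * inverse D * (inverse d / 2)"
    and "\<beta> = - (\<kappa> * inverse D * inverse D * (\<kappa> - u x * inverse d))"
  have "\<kappa> * - (j * (\<kappa> * q - (p + (u x * q + q * u x)) * (i / 2)) * j) =
      (\<kappa> * j * j * (i / 2)) * p - (\<kappa> * j * j * (\<kappa> - u x * i)) * q" for p q i j :: real
    by (simp add: field_simps)
  then have "((\<lambda>x. \<kappa> / snell_denom \<kappa> (S x) (u x)) has_derivative
      (\<lambda>h. (\<alpha> *\<^sub>R grad ?s x + \<beta> *\<^sub>R grad u x) \<bullet> h)) (at x)"
    using dcoeff by (simp only: \<alpha>_def \<beta>_def inner_add_left inner_scaleR_left) simp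
  then have "grad (\<lambda>x. \<kappa> / snell_denom \<kappa> (S x) (u x)) x = \<alpha> *\<^sub>R grad ?s x + \<beta> *\<^sub>R grad u x"
    by (rule grad_eqI)
  then have "cross2 (S x) (grad (\<lambda>x. \<kappa> / snell_denom \<kappa> (S x) (u x)) x) =
      \<alpha> * cross2 (S x) (grad ?s x) + \<beta> * cross2 (S x) (grad u x)"
    by (simp add: cross2_def algebra_simps)
  with assms(3,4) show ?thesis by simp
qed

section \<open>Sign and Lipschitz estimates for the refraction coefficient\<close>

lemma snell_denom_pos:
  assumes "\<kappa> > 1" "norm v / sqrt (\<kappa>\<^sup>2 - 1) < z"
  shows "snell_denom \<kappa> v z > 0"
proof -
  have \<kappa>: "\<kappa>\<^sup>2 - 1 > 0" using assms(1) by simp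
  then have z: "z > 0" using assms(2) by (smt (verit) divide_nonneg_pos norm_ge_zero real_sqrt_gt_zero)
  have "norm v < z * sqrt (\<kappa>\<^sup>2 - 1)" using assms(2) \<kappa> by (simp add: pos_divide_less_eq)
  then have "(norm v)\<^sup>2 < (z * sqrt (\<kappa>\<^sup>2 - 1))\<^sup>2" by (intro power_strict_mono) auto
  then have "(norm v)\<^sup>2 + z\<^sup>2 < (\<kappa> * z)\<^sup>2"
    using \<kappa> by (simp add: power_mult_distrib algebra_simps)
  then have "sqrt ((norm v)\<^sup>2 + z\<^sup>2) < \<kappa> * z"
    using z assms(1) by (intro real_less_lsqrt) auto
  then show ?thesis by (simp add: snell_denom_def)
qed

text \<open>The square root is the norm of \<open>pt3 v z\<close>, so the reverse triangle
  inequality gives it the Lipschitz constant 1, uniformly in \<open>v\<close>.\<close>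

lemma snell_denom_lipschitz:
  assumes "\<kappa> \<ge> 0"
  shows "\<bar>snell_denom \<kappa> v z - snell_denom \<kappa> v w\<bar> \<le> (\<kappa> + 1) * \<bar>z - w\<bar>"
proof -
  have "\<bar>norm (pt3 v z) - norm (pt3 v w)\<bar> \<le> norm (pt3 v z - pt3 v w)"
    by (rule norm_triangle_ineq3)
  then have "\<bar>sqrt ((norm v)\<^sup>2 + z\<^sup>2) - sqrt ((norm v)\<^sup>2 + w\<^sup>2)\<bar> \<le> \<bar>z - w\<bar>"
    by (simp add: norm_pt3 pt3_diff)
  moreover have "\<bar>\<kappa> * z - \<kappa> * w\<bar> = \<kappa> * \<bar>z - w\<bar>"
    using assms by (simp add: abs_mult flip: right_diff_distrib)
  ultimately show ?thesis unfolding snell_denom_def by (simp add: algebra_simps)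
qed

lemma snell_coefficient_lipschitz:
  assumes "\<kappa> > 0" "\<delta> > 0" "snell_denom \<kappa> v z > \<delta>" "snell_denom \<kappa> v w > \<delta>"
  shows "\<bar>\<kappa> / snell_denom \<kappa> v z - \<kappa> / snell_denom \<kappa> v w\<bar> \<le> \<kappa> * (\<kappa> + 1) / \<delta>\<^sup>2 * \<bar>z - w\<bar>"
proof -
  let ?D = "snell_denom \<kappa> v"
  have "\<bar>\<kappa> / ?D z - \<kappa> / ?D w\<bar> = \<kappa> * \<bar>?D z - ?D w\<bar> / (?D z * ?D w)"
  proof -
    have "\<kappa> / ?D z - \<kappa> / ?D w = \<kappa> * (?D w - ?D z) / (?D z * ?D w)"
      using assms by (simp add: field_simps)
    then show ?thesis using assms by (simp add: abs_mult abs_minus_commute)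
  qed
  also have "\<dots> \<le> \<kappa> * ((\<kappa> + 1) * \<bar>z - w\<bar>) / (\<delta> * \<delta>)"
    using assms snell_denom_lipschitz[of \<kappa> v z w]
    by (intro frac_le mult_mono mult_left_mono) auto
  finally show ?thesis by (simp add: power2_eq_square mult.assoc)
qed

text \<open>The partials of \<open>f\<close> are the components of \<omega>, so one order is
  gained.\<close>

lemma Ck_on_potential:
  assumes "open U" "Ck_on k \<omega> U" "\<And>x. x \<in> U \<Longrightarrow> (f has_derivative (\<lambda>h. \<omega> x \<bullet> h)) (at x)"
  shows "Ck_on (Suc k) f U"
  using assms(3)
  by (rule Ck_on_SucI[OF assms(1)]) (simp_all add: inner_axis Ck_on_nth assms)

lemma refraction_equation_has_solution:
  fixes S :: "real^2 \<Rightarrow> real^2"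
  assumes \<kappa>: "\<kappa> > 1" and z0: "norm (S x0) / sqrt (\<kappa>\<^sup>2 - 1) < z0" "z0 < a"
    and N: "open N" "x0 \<in> N" and S: "Ck_on 1 S N"
    and curl: "\<And>x. x \<in> N \<Longrightarrow> curl2 S x = 0"
    and cross: "\<And>x. x \<in> N \<Longrightarrow> cross2 (S x) (grad (\<lambda>y. (norm (S y))\<^sup>2) x) = 0"
  obtains r z where "r > 0" "ball x0 r \<subseteq> N" "z x0 = z0"
    "\<And>x. x \<in> ball x0 r \<Longrightarrow> 0 < z x \<and> z x < a \<and> snell_denom \<kappa> (S x) (z x) > 0"
    "\<And>x. x \<in> ball x0 r \<Longrightarrow>
      (z has_derivative (\<lambda>h. ((\<kappa> / snell_denom \<kappa> (S x) (z x)) *\<^sub>R S x) \<bullet> h)) (at x)"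
proof -
  \<comment> \<open>Half of the value at \<open>(x0, z0)\<close>, which by continuity remains a
    strict lower bound of the denominator nearby.\<close>
  define \<delta> where "\<delta> = snell_denom \<kappa> (S x0) z0 / 2"
  define b where "b = norm (S x0) + 1"
  have \<delta>: "\<delta> > 0" "\<delta> < snell_denom \<kappa> (S x0) z0"
    using snell_denom_pos[OF \<kappa> z0(1)] by (simp_all add: \<delta>_def)
  have b: "b > 0" by (simp add: b_def add_nonneg_pos)
  have "z0 > 0"
  proof -
    have "norm (S x0) / sqrt (\<kappa>\<^sup>2 - 1) \<ge> 0" using \<kappa> by simp
    then show ?thesis using z0(1) by linarith
  qed
  \<comment> \<open>The open set of pairs \<open>(x, z)\<close> on which the estimates hold with
    uniform constants; a box inside it separates the restriction on \<open>x\<close> from that on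
    \<open>z\<close>.\<close>
  define W where "W = (N \<times> {0<..<a}) \<inter>
    (\<lambda>p. (snell_denom \<kappa> (S (fst p)) (snd p), norm (S (fst p)))) -` ({\<delta><..} \<times> {..<b})"
  have "open W"
    unfolding W_def snell_denom_def
    by (intro continuous_open_preimage open_Times N continuous_intros
        continuous_on_compose2[OF Ck_on_continuous[OF S]]) auto
  moreover have "(x0, z0) \<in> W"
    using N \<open>z0 > 0\<close> z0(2) \<delta> by (simp add: W_def b_def)
  ultimately obtain A C where AC: "open A" "open C" "x0 \<in> A" "z0 \<in> C" "A \<times> C \<subseteq> W"
    by (rule open_prod_elim) blast
  obtain r1 where r1: "r1 > 0" "ball x0 r1 \<subseteq> A" using AC open_contains_ball by blast
  obtain e where e: "e > 0" "cball z0 e \<subseteq> C" using AC open_contains_cball by blast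
  define M where "M = \<kappa> / \<delta> * b"
  define L where "L = \<kappa> * (\<kappa> + 1) / \<delta>\<^sup>2 * b"
  have nonneg: "M \<ge> 0" "L \<ge> 0" using \<kappa> \<delta> b by (simp_all add: M_def L_def)
  \<comment> \<open>The first bound keeps \<open>x\<close> in the box, the other two give the
    smallness conditions of the iteration. Adding 1 makes the quotients meaningful for any
    nonnegative \<open>M\<close> and \<open>L\<close>.\<close>
  define r where "r = min r1 (min (e / (M + 1)) (1 / (2 * (L + 1))))"
  have r: "r > 0" "M * r \<le> e" "L * r \<le> 1 / 2"
  proof -
    show "r > 0" using r1 e nonneg by (simp add: r_def)
    have "M * r \<le> (M + 1) * (e / (M + 1))"
      using nonneg e \<open>r > 0\<close> by (intro mult_mono) (auto simp: r_def)
    then show "M * r \<le> e" using nonneg by simp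
    have "L * r \<le> (L + 1) * (1 / (2 * (L + 1)))"
      using nonneg \<open>r > 0\<close> by (intro mult_mono) (auto simp: r_def)
    also have "\<dots> = 1 / 2" using nonneg by (simp add: field_simps)
    finally show "L * r \<le> 1 / 2" .
  qed
  let ?B = "ball x0 r"
  have W: "x \<in> N" "0 < z" "z < a" "snell_denom \<kappa> (S x) z > \<delta>" "norm (S x) < b"
    if "x \<in> ?B" "\<bar>z - z0\<bar> \<le> e" for x z
  proof -
    have "x \<in> A" using that r1 by (auto simp: r_def)
    moreover have "z \<in> C" using that e by (auto simp: dist_real_def abs_minus_commute)
    ultimately have "(x, z) \<in> W" using AC by blast
    then show "x \<in> N" "0 < z" "z < a" "snell_denom \<kappa> (S x) z > \<delta>" "norm (S x) < b"
      by (auto simp: W_def)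
  qed
  have "?B \<subseteq> N" using W(1)[of _ z0] e by auto
  then have SB: "Ck_on 1 S ?B" using Ck_on_subset[OF S] by blast
  define F where "F x z = (\<kappa> / snell_denom \<kappa> (S x) z) *\<^sub>R S x" for x z
  \<comment> \<open>The invariant of the iteration: class C^1 with gradient parallel to
    \<open>S\<close>.\<close>
  define P where "P u \<longleftrightarrow> Ck_on 1 u ?B \<and> (\<forall>x\<in>?B. cross2 (S x) (grad u x) = 0)" for u
  show ?thesis
  proof (rule gradient_equation_exists_by_iteration[where F = F and P = P and ?x0.0 = x0 and r = r
        and ?z0.0 = z0 and e = e and M = M and L = L])
    show "norm (F x z) \<le> M" if "x \<in> ?B" "\<bar>z - z0\<bar> \<le> e" for x z
    proof -
      have "norm (F x z) = \<kappa> / snell_denom \<kappa> (S x) z * norm (S x)"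
        using W(4)[OF that] \<kappa> \<delta> by (simp add: F_def)
      also have "\<dots> \<le> \<kappa> / \<delta> * b"
        using W(4,5)[OF that] \<kappa> \<delta> b by (intro mult_mono divide_left_mono) auto
      finally show ?thesis by (simp add: M_def)
    qed
    show "norm (F x z - F x w) \<le> L * \<bar>z - w\<bar>"
      if "x \<in> ?B" "\<bar>z - z0\<bar> \<le> e" "\<bar>w - z0\<bar> \<le> e" for x z w
    proof -
      have "norm (F x z - F x w) =
          \<bar>\<kappa> / snell_denom \<kappa> (S x) z - \<kappa> / snell_denom \<kappa> (S x) w\<bar> * norm (S x)"
        unfolding F_def by (metis norm_scaleR scaleR_diff_left)
      also have "\<dots> \<le> (\<kappa> * (\<kappa> + 1) / \<delta>\<^sup>2 * \<bar>z - w\<bar>) * b"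
        using W[OF that(1,2)] W[OF that(1,3)] \<kappa> \<delta> b
        by (intro mult_mono snell_coefficient_lipschitz) auto
      finally show ?thesis by (simp add: L_def mult_ac)
    qed
    have "grad (\<lambda>_. z0) x = (0 :: real^2)" for x by (rule grad_eqI) simp
    then show "P (\<lambda>_. z0)" by (simp add: P_def Ck_on_const cross2_def del: One_nat_def)
  next
    fix u assume u: "P u" "\<And>x. x \<in> ?B \<Longrightarrow> \<bar>u x - z0\<bar> \<le> e"
    let ?g = "\<lambda>x. \<kappa> / snell_denom \<kappa> (S x) (u x)"
    have D: "snell_denom \<kappa> (S x) (u x) > 0" "u x > 0" if "x \<in> ?B" for x
      using W[OF that u(2)[OF that]] \<delta> by auto
    have g: "Ck_on 1 ?g ?B"
      using u(1) D by (intro Ck_on_snell_coefficient SB) (auto simp: P_def simp del: One_nat_def)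
    have F: "Ck_on 1 (\<lambda>x. F x (u x)) ?B"
      unfolding F_def by (rule Ck_on_scaleR[OF open_ball g SB])
    have "curl2 (\<lambda>x. F x (u x)) x = 0" if x: "x \<in> ?B" for x
    proof -
      have diff: "S differentiable (at x)" "u differentiable (at x)" "?g differentiable (at x)"
        using SB g u(1) x by (auto simp: P_def)
      have "x \<in> N" using x \<open>?B \<subseteq> N\<close> by blast
      then have "cross2 (S x) (grad ?g x) = 0"
        using x u(1) D[OF x] by (intro cross2_grad_snell_coefficient diff cross) (auto simp: P_def)
      then show ?thesis
        unfolding F_def using curl2_scaleR[OF diff(3,1)] curl[OF \<open>x \<in> N\<close>] by simp
    qed
    then obtain v where v: "v x0 = z0"
      "\<And>x. x \<in> ?B \<Longrightarrow> (v has_derivative (\<lambda>h. F x (u x) \<bullet> h)) (at x)"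
      using curl_free_field_has_potential[OF F] by metis
    have "Ck_on 1 v ?B"
      unfolding One_nat_def by (rule Ck_on_potential[OF open_ball Ck_on_SucD v(2)]) (use F in simp_all)
    \<comment> \<open>The new gradient is \<open>F x (u x)\<close>, a multiple of
      \<open>S x\<close>, so the invariant reproduces itself.\<close>
    moreover have "cross2 (S x) (grad v x) = 0" if "x \<in> ?B" for x
      using grad_eqI[OF v(2)[OF that]] by (simp add: F_def cross2_def)
    ultimately show "\<exists>v. P v \<and> v x0 = z0 \<and> (\<forall>x\<in>?B. (v has_derivative (\<lambda>h. F x (u x) \<bullet> h)) (at x))"
      using v by (auto simp: P_def)
  next
    fix z assume z: "z x0 = z0" "\<And>x. x \<in> ?B \<Longrightarrow> \<bar>z x - z0\<bar> \<le> e"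
      "\<And>x. x \<in> ?B \<Longrightarrow> (z has_derivative (\<lambda>h. F x (z x) \<bullet> h)) (at x)"
    have "0 < z x \<and> z x < a \<and> snell_denom \<kappa> (S x) (z x) > 0" if "x \<in> ?B" for x
      using W[OF that z(2)[OF that]] \<delta> by auto
    then show thesis
      using that[of r z] r(1) \<open>?B \<subseteq> N\<close> z(1) z(3)[unfolded F_def] by blast
  qed (use r e nonneg in auto)
qed

text \<open>The phase is extended to space independently of the third coordinate, so its gradient is
  horizontal; \<open>W\<close> is the vertical cylinder over the image of \<open>V\<close>.\<close>

lemma phase_discontinuity_exists:
  fixes T S :: "real^2 \<Rightarrow> real^2" and z :: "real^2 \<Rightarrow> real"
  assumes T: "diffeomorphism_on T N" and V: "open V" "V \<subseteq> N"
    and S: "\<And>x. S x = T x - x" and "\<kappa> > 0"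
    and z: "\<And>x. x \<in> V \<Longrightarrow>
      (z has_derivative (\<lambda>h. ((\<kappa> / snell_denom \<kappa> (S x) (z x)) *\<^sub>R S x) \<bullet> h)) (at x)"
    and pos: "\<And>x. x \<in> V \<Longrightarrow> z x > 0" "\<And>x. x \<in> V \<Longrightarrow> snell_denom \<kappa> (S x) (z x) > 0"
  obtains W \<phi> where "open W" "\<And>x. x \<in> V \<Longrightarrow> pt3 (T x) a \<in> W" "Ck_on 1 \<phi> W"
    "\<And>x. x \<in> V \<Longrightarrow> grad \<phi> (pt3 (T x) a) = pt3 (k *\<^sub>R (S x /\<^sub>R sqrt ((norm (S x))\<^sup>2 + (z x)\<^sup>2))) 0"
proof -
  define G where "G = inv_into N T"
  have T': "open (T ` N)" "inj_on T N" "Ck_on 1 T N" "Ck_on 1 G (T ` N)"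
    using T by (auto simp: diffeomorphism_on_def G_def)
  have GT: "G (T x) = x" if "x \<in> N" for x using that T'(2) by (simp add: G_def)
  have contG: "continuous_on (T ` N) G" using T'(4) by (rule Ck_on_continuous)
  \<comment> \<open>This is the image of \<open>V\<close> under \<open>T\<close>, written as a
    preimage under the continuous inverse to make its openness visible.\<close>
  define Y where "Y = T ` N \<inter> G -` V"
  have "open Y" unfolding Y_def by (rule continuous_open_preimage[OF contG T'(1) V(1)])
  have GY: "G y \<in> V" "T (G y) = y" if "y \<in> Y" for y
    using that GT by (auto simp: Y_def)
  have TY: "T x \<in> Y" if "x \<in> V" for x using that V GT by (auto simp: Y_def)
  define p :: "real^3 \<Rightarrow> real^2" where "p u = vector [u $ 1, u $ 2]" for u
  have p_pt3: "p (pt3 y t) = y" for y t by (simp add: p_def vec_eq_iff forall_2)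
  have "linear p"
    by (rule linearI) (simp_all add: p_def vec_eq_iff forall_2)
  then have p: "bounded_linear p" by (simp add: linear_linear)
  define d where "d x = sqrt ((norm (S x))\<^sup>2 + (z x)\<^sup>2)" for x
  \<comment> \<open>The factor \<open>k / \<kappa>\<close> turns the Malus gradient
    \<open>\<kappa> / d\<close> times \<open>S\<close> into \<open>k / d\<close> times
    \<open>S\<close>.\<close>
  define \<Theta> where "\<Theta> x = k / \<kappa> * (a - z x + \<kappa> * sqrt ((norm (S x))\<^sup>2 + (z x)\<^sup>2))" for x
  define \<phi> where "\<phi> u = \<Theta> (G (p u))" for u
  define m where "m x = (k / d x) *\<^sub>R S x" for x
  define W where "W = p -` Y"
  have "open W"
    unfolding W_def by (rule open_vimage[OF \<open>open Y\<close> linear_continuous_on[OF p]])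
  have d\<phi>: "(\<phi> has_derivative (\<lambda>h. m (G (p u)) \<bullet> p h)) (at u)" if "u \<in> W" for u
  proof -
    define y x where "y = p u" and "x = G y"
    have y: "y \<in> Y" using that by (simp add: W_def y_def)
    have x: "x \<in> V" "T x = y" using GY[OF y] by (simp_all add: x_def)
    obtain T1 where T1: "(T has_derivative T1) (at x)"
      using Ck_on_differentiable[OF T'(3)[unfolded One_nat_def]] x(1) V(2)
      unfolding differentiable_def by blast
    obtain G1 where G1: "(G has_derivative G1) (at y)"
      using Ck_on_differentiable[OF T'(4)[unfolded One_nat_def]] y
      unfolding differentiable_def Y_def by blast
    \<comment> \<open>Differentiating \<open>T (G y) = y\<close> shows that \<open>T1\<close> undoes
      \<open>G1\<close>.\<close>
    have "((\<lambda>y. T (G y)) has_derivative (\<lambda>h. T1 (G1 h))) (at y)"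
      using has_derivative_compose[OF G1 T1[unfolded x_def]] .
    then have "((\<lambda>y. y) has_derivative (\<lambda>h. T1 (G1 h))) (at y)"
      by (rule has_derivative_transform_within_open[OF _ \<open>open Y\<close> y GY(2)])
    from has_derivative_unique[OF this has_derivative_ident]
    have TG: "T1 (G1 h) = h" for h by (rule fun_cong)
    \<comment> \<open>Hence \<open>h + S' h\<close> in the Malus formula is \<open>T1 h\<close>, and
      composition with \<open>G1\<close> leaves \<open>h\<close>: the gradient with respect to the
      target is \<open>m x\<close>.\<close>
    have S1: "(S has_derivative (\<lambda>h. T1 h - h)) (at x)"
      using has_derivative_diff[OF T1 has_derivative_ident] by (simp add: S[abs_def])
    have "\<kappa> * z x - sqrt ((norm (S x))\<^sup>2 + (z x)\<^sup>2) \<noteq> 0"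
      using pos(2)[OF x(1)] by (simp add: snell_denom_def)
    from has_derivative_mult_right[OF has_derivative_optical_path[OF S1
        z[OF x(1), unfolded snell_denom_def] refl pos(1)[OF x(1)] this], of "k / \<kappa>" a]
    have "(\<Theta> has_derivative (\<lambda>h. k / \<kappa> * (((\<kappa> / d x) *\<^sub>R S x) \<bullet> (h + (T1 h - h))))) (at x)"
      unfolding \<Theta>_def[abs_def] d_def .
    then have "(\<Theta> has_derivative (\<lambda>h. m x \<bullet> T1 h)) (at x)"
      using \<open>\<kappa> > 0\<close> by (simp add: m_def)
    from has_derivative_compose[OF G1 this[unfolded x_def]]
    have "((\<lambda>y. \<Theta> (G y)) has_derivative (\<lambda>h. m x \<bullet> h)) (at y)"
      by (simp add: TG x_def)
    from has_derivative_compose[OF bounded_linear_imp_has_derivative[OF p] this[unfolded y_def]]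
    show ?thesis by (simp add: \<phi>_def[abs_def] x_def y_def)
  qed
  show ?thesis
  proof
    show "open W" by fact
    show "pt3 (T x) a \<in> W" if "x \<in> V" for x using TY[OF that] by (simp add: W_def p_pt3)
    \<comment> \<open>The derivative of \<phi> is explicit, so class C^1 amounts to continuity of
      \<open>m (G (p u))\<close> in \<open>u\<close>.\<close>
    have contz: "continuous_on V z"
      using z by (meson continuous_at_imp_continuous_on has_derivative_continuous)
    have "continuous_on V S"
      unfolding S[abs_def]
      using continuous_on_subset[OF Ck_on_continuous[OF T'(3)] V(2)] by (intro continuous_intros)
    moreover have "d x \<noteq> 0" if "x \<in> V" for x
      using pos(1)[OF that] by (simp add: d_def add_nonneg_eq_0_iff)
    ultimately have "continuous_on V m"
      using contz unfolding m_def[abs_def] d_def by (intro continuous_intros) auto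
    moreover have "continuous_on W (\<lambda>u. G (p u))"
      by (rule continuous_on_compose2[OF contG linear_continuous_on[OF p]]) (auto simp: W_def Y_def)
    ultimately have "continuous_on W (\<lambda>u. m (G (p u)))"
      by (rule continuous_on_compose2) (auto simp: W_def GY(1))
    then show "Ck_on 1 \<phi> W"
      unfolding One_nat_def by (intro Ck_on_SucI[OF \<open>open W\<close> d\<phi>]) (auto intro!: continuous_intros)
    fix x assume x: "x \<in> V"
    have "m x \<bullet> p h = pt3 (m x) 0 \<bullet> h" for h
      by (simp add: p_def inner_vec_def sum_2 sum_3)
    then have "(\<phi> has_derivative (\<lambda>h. pt3 (m x) 0 \<bullet> h)) (at (pt3 (T x) a))"
      using d\<phi>[of "pt3 (T x) a"] TY[OF x] x V GT by (simp add: W_def p_pt3 subset_iff)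
    then have "grad \<phi> (pt3 (T x) a) = pt3 (m x) 0" by (rule grad_eqI)
    then show "grad \<phi> (pt3 (T x) a) = pt3 (k *\<^sub>R (S x /\<^sub>R sqrt ((norm (S x))\<^sup>2 + (z x)\<^sup>2))) 0"
      by (simp add: m_def d_def divide_inverse)
  qed
qed

section \<open>Assembly: regularity of the surface, refraction at it, and the phase on the
  metasurface\<close>

theorem mainTheorem10:
  fixes \<Omega> \<Omega>' :: "(real^2) set"
    and T S :: "real^2 \<Rightarrow> real^2"
    and a c k n\<^sub>1 n\<^sub>2 n\<^sub>3 \<kappa>\<^sub>1 \<kappa>\<^sub>2 :: real
    and x\<^sub>0 :: "real^2"
  assumes "open \<Omega>" "simply_connected \<Omega>"
    and "open \<Omega>'" "simply_connected \<Omega>'"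
    and "a > 0" "c > a" "k > 0"
    and "Ck_on 2 T \<Omega>" "bij_betw T \<Omega> \<Omega>'"
    and "\<And>x. S x = T x - x"
    and "n\<^sub>1 > 0" "n\<^sub>2 > 0" "n\<^sub>3 > 0" "n\<^sub>2 > n\<^sub>1"
    and "\<kappa>\<^sub>1 = n\<^sub>2 / n\<^sub>1" "\<kappa>\<^sub>2 = n\<^sub>3 / n\<^sub>2"
    and "x\<^sub>0 \<in> \<Omega>"
    and "a > norm (S x\<^sub>0) / sqrt (\<kappa>\<^sub>1\<^sup>2 - 1)"
    and "\<exists>N. open N \<and> x\<^sub>0 \<in> N \<and> N \<subseteq> \<Omega> \<and>
           (\<forall>x\<in>N. curl2 S x = 0 \<and> cross2 (S x) (grad (\<lambda>y. (norm (S y))\<^sup>2) x) = 0)"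
  shows "\<forall>z\<^sub>0. a > z\<^sub>0 \<and> z\<^sub>0 > norm (S x\<^sub>0) / sqrt (\<kappa>\<^sub>1\<^sup>2 - 1) \<longrightarrow>
    (\<exists>U \<rho>. open U \<and> x\<^sub>0 \<in> U \<and> U \<subseteq> \<Omega> \<and>
       Ck_on 3 \<rho> U \<and> (\<forall>x\<in>U. \<rho> x > 0) \<and>
       (\<forall>x\<in>U. sqrt ((norm (S x))\<^sup>2 + (a - \<rho> x)\<^sup>2) - \<kappa>\<^sub>1 * (a - \<rho> x) \<noteq> 0 \<and>
          grad \<rho> x =
            (\<kappa>\<^sub>1 / (sqrt ((norm (S x))\<^sup>2 + (a - \<rho> x)\<^sup>2) - \<kappa>\<^sub>1 * (a - \<rho> x))) *\<^sub>R S x) \<and>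
       a - \<rho> x\<^sub>0 = z\<^sub>0 \<and>
       (\<forall>x\<in>U. refracts_into \<kappa>\<^sub>1 \<rho> a x (T x)) \<and>
       ((\<exists>N. x\<^sub>0 \<in> N \<and> N \<subseteq> \<Omega> \<and> diffeomorphism_on T N) \<and>
        (S x\<^sub>0 = 0 \<and> invertible (jacobian S (at x\<^sub>0)) \<or>
         S x\<^sub>0 \<noteq> 0 \<and>
         (\<exists>\<zeta> \<zeta>\<^sub>p. jacobian S (at x\<^sub>0) *v S x\<^sub>0 = \<zeta> *\<^sub>R S x\<^sub>0 \<and>
            jacobian S (at x\<^sub>0) *v perp (S x\<^sub>0) = \<zeta>\<^sub>p *\<^sub>R perp (S x\<^sub>0) \<and>
            \<zeta> \<noteq> (norm (S x\<^sub>0))\<^sup>2 / z\<^sub>0\<^sup>2 * varphi \<kappa>\<^sub>1 ((norm (S x\<^sub>0 /\<^sub>R z\<^sub>0))\<^sup>2) \<and>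
            \<zeta>\<^sub>p \<noteq> 0))
        \<longrightarrow>
        (\<exists>V W \<phi>. open V \<and> x\<^sub>0 \<in> V \<and> V \<subseteq> U \<and>
           open W \<and> (\<forall>x\<in>V. pt3 (T x) a \<in> W) \<and> Ck_on 1 \<phi> W \<and>
           (\<forall>x\<in>V. metasurface_refracts_vertically_into k \<kappa>\<^sub>2 \<phi>
                    (refracted_dir \<kappa>\<^sub>1 \<rho> x) (T x) a c))))"
proof (intro allI impI, goal_cases)
  case (1 z\<^sub>0)
  then have z0: "norm (S x\<^sub>0) / sqrt (\<kappa>\<^sub>1\<^sup>2 - 1) < z\<^sub>0" "z\<^sub>0 < a" by simp_all
  have \<kappa>: "\<kappa>\<^sub>1 > 1" "\<kappa>\<^sub>2 > 0" using assms(11-16) by simp_all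
  have S: "S = (\<lambda>x. T x - x)" using assms(10) by blast
  obtain N where N: "open N" "x\<^sub>0 \<in> N" "N \<subseteq> \<Omega>" "\<And>x. x \<in> N \<Longrightarrow> curl2 S x = 0"
    "\<And>x. x \<in> N \<Longrightarrow> cross2 (S x) (grad (\<lambda>y. (norm (S y))\<^sup>2) x) = 0"
    using assms(19) by blast
  have S2: "Ck_on 2 S N"
    unfolding S by (intro Ck_on_diff Ck_on_id N(1) Ck_on_subset[OF assms(8) N(3)])
  then have S1: "Ck_on 1 S N" using Ck_on_SucD[of 1 S N] by (simp add: numeral_2_eq_2)
  obtain r z where r: "r > 0" "ball x\<^sub>0 r \<subseteq> N" and zx0: "z x\<^sub>0 = z\<^sub>0"
    and pos: "\<And>x. x \<in> ball x\<^sub>0 r \<Longrightarrow> 0 < z x \<and> z x < a \<and> snell_denom \<kappa>\<^sub>1 (S x) (z x) > 0"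
    and dz: "\<And>x. x \<in> ball x\<^sub>0 r \<Longrightarrow>
      (z has_derivative (\<lambda>h. ((\<kappa>\<^sub>1 / snell_denom \<kappa>\<^sub>1 (S x) (z x)) *\<^sub>R S x) \<bullet> h)) (at x)"
    by (rule refraction_equation_has_solution[OF \<kappa>(1) z0 N(1,2) S1 N(4,5)])
      (assumption | rule that)+
  define U where "U = ball x\<^sub>0 r"
  define \<rho> where "\<rho> x = a - z x" for x
  have U: "open U" "x\<^sub>0 \<in> U" "U \<subseteq> N" using r by (simp_all add: U_def)
  note pos = pos[folded U_def] and dz = dz[folded U_def]
  \<comment> \<open>The gradient of \<open>z\<close> is as smooth as \<open>z\<close> and
    \<open>S\<close> together, so each round gains one order while \<open>S\<close> can follow. As
    \<open>S\<close> is C^2, three rounds lead from continuity to C^3.\<close>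
  have bootstrap: "Ck_on (Suc k) z U" if "Ck_on k z U" "k \<le> 2" for k
  proof -
    have "Ck_on k S N" using S2 S1 Ck_on_SucD[of 0 S N] that(2) by (auto simp: le_Suc_eq numeral_2_eq_2 simp del: Ck_on.simps)
    then have "Ck_on k S U" using U(3) Ck_on_subset by blast
    then show ?thesis
      using pos by (intro Ck_on_potential[OF U(1) Ck_on_scaleR[OF U(1) Ck_on_snell_coefficient] dz] U(1) that(1)) auto
  qed
  have "continuous_on U z"
    using dz by (meson continuous_at_imp_continuous_on has_derivative_continuous)
  then have "Ck_on 0 z U" by simp
  then have "Ck_on 3 z U" using bootstrap[of 0] bootstrap[of 1] bootstrap[of 2] by (simp add: eval_nat_numeral del: Ck_on.simps)
  then have \<rho>3: "Ck_on 3 \<rho> U"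
    unfolding \<rho>_def[abs_def] by (intro Ck_on_diff Ck_on_const U(1))
  have grad: "grad \<rho> x = - (\<kappa>\<^sub>1 / snell_denom \<kappa>\<^sub>1 (S x) (z x)) *\<^sub>R S x" if "x \<in> U" for x
    using has_derivative_diff[OF has_derivative_const dz[OF that], of a]
    by (intro grad_eqI) (simp add: \<rho>_def[abs_def])
  have refr: "refracts_into \<kappa>\<^sub>1 \<rho> a x (T x)" if "x \<in> U" for x
    using pos[OF that] \<kappa> grad[OF that]
    by (intro refracts_into_if_grad[where D = "snell_denom \<kappa>\<^sub>1 (S x) (z x)"])
      (simp_all add: \<rho>_def snell_denom_def S)
  have eq: "sqrt ((norm (S x))\<^sup>2 + (a - \<rho> x)\<^sup>2) - \<kappa>\<^sub>1 * (a - \<rho> x) \<noteq> 0 \<and>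
      grad \<rho> x = (\<kappa>\<^sub>1 / (sqrt ((norm (S x))\<^sup>2 + (a - \<rho> x)\<^sup>2) - \<kappa>\<^sub>1 * (a - \<rho> x))) *\<^sub>R S x"
    if "x \<in> U" for x
  proof -
    \<comment> \<open>The sign change here cancels the one caused by passing from \<open>z\<close>
      to \<open>\<rho> = a - z\<close>.\<close>
    have "sqrt ((norm (S x))\<^sup>2 + (a - \<rho> x)\<^sup>2) - \<kappa>\<^sub>1 * (a - \<rho> x) = - snell_denom \<kappa>\<^sub>1 (S x) (z x)"
      by (simp add: \<rho>_def snell_denom_def)
    then show ?thesis using pos[OF that] grad[OF that] by simp
  qed
  have phase: "\<exists>V W \<phi>. open V \<and> x\<^sub>0 \<in> V \<and> V \<subseteq> U \<and>
      open W \<and> (\<forall>x\<in>V. pt3 (T x) a \<in> W) \<and> Ck_on 1 \<phi> W \<and>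
      (\<forall>x\<in>V. metasurface_refracts_vertically_into k \<kappa>\<^sub>2 \<phi> (refracted_dir \<kappa>\<^sub>1 \<rho> x) (T x) a c)"
    if M: "x\<^sub>0 \<in> M" "diffeomorphism_on T M" for M
  proof -
    \<comment> \<open>On this set both the solution and the local inverse of \<open>T\<close> are
      available.\<close>
    define V where "V = U \<inter> M"
    have V: "open V" "V \<subseteq> U" "V \<subseteq> M" "x\<^sub>0 \<in> V"
      using U M by (auto simp: V_def diffeomorphism_on_def)
    obtain W \<phi> where W: "open W" "\<And>x. x \<in> V \<Longrightarrow> pt3 (T x) a \<in> W" "Ck_on 1 \<phi> W"
      "\<And>x. x \<in> V \<Longrightarrow> grad \<phi> (pt3 (T x) a) = pt3 (k *\<^sub>R (S x /\<^sub>R sqrt ((norm (S x))\<^sup>2 + (z x)\<^sup>2))) 0"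
      by (rule phase_discontinuity_exists[where a = a and k = k,
            OF M(2) V(1,3) assms(10) _ dz[OF subsetD[OF V(2)]]]) (use V(2) \<kappa>(1) pos that in auto)
    have "metasurface_refracts_vertically_into k \<kappa>\<^sub>2 \<phi> (refracted_dir \<kappa>\<^sub>1 \<rho> x) (T x) a c"
      if "x \<in> V" for x
    proof -
      have x: "x \<in> U" using that V by blast
      \<comment> \<open>The horizontal part of the refracted ray; \<open>k\<close> times it is the
        phase gradient at the target.\<close>
      have "refracted_dir \<kappa>\<^sub>1 \<rho> x = pt3 (S x /\<^sub>R sqrt ((norm (S x))\<^sup>2 + (z x)\<^sup>2))
          (z x / sqrt ((norm (S x))\<^sup>2 + (z x)\<^sup>2))"
        using pos[OF x] \<kappa> grad[OF x]
        by (intro refracted_dir_eq[where D = "snell_denom \<kappa>\<^sub>1 (S x) (z x)"])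
          (simp_all add: snell_denom_def)
      then show ?thesis
        using metasurface_refracts_vertically_intoI[OF assms(7) \<kappa>(2) assms(6) W(4)[OF that]] by simp
    qed
    then show ?thesis using V W(1-3) by blast
  qed
  have "U \<subseteq> \<Omega>" "\<And>x. x \<in> U \<Longrightarrow> \<rho> x > 0" "a - \<rho> x\<^sub>0 = z\<^sub>0"
    using U N pos zx0 by (auto simp: \<rho>_def)
  note \<rho> = this
  show ?case
  proof (rule exI[of _ U], rule exI[of _ \<rho>], intro conjI ballI impI)
    fix x assume x: "x \<in> U"
    show "\<rho> x > 0" "refracts_into \<kappa>\<^sub>1 \<rho> a x (T x)" using \<rho>(2) refr x by blast+
    show "sqrt ((norm (S x))\<^sup>2 + (a - \<rho> x)\<^sup>2) - \<kappa>\<^sub>1 * (a - \<rho> x) \<noteq> 0"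
      "grad \<rho> x = (\<kappa>\<^sub>1 / (sqrt ((norm (S x))\<^sup>2 + (a - \<rho> x)\<^sup>2) - \<kappa>\<^sub>1 * (a - \<rho> x))) *\<^sub>R S x"
      using eq[OF x] by blast+
  qed (use U(1,2) \<rho>3 \<rho>(1,3) phase in blast)+
qed

end
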